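(* Let $q$ be a complex number with $0<|q|<1$ and let $a,b,c,d$ be nonzero complex numbers. Let $\varepsilon_b,\varepsilon_c,\varepsilon_d,\varepsilon_e,\lambda_b,\lambda_c,\lambda_d,\lambda_e$ be nonnegative integers with $\Lambda:=\lambda_b+\lambda_c+\lambda_d+\lambda_e\ge 1$ such that, with $\langle n\rangle_x:=\left\lfloor\frac{\varepsilon_x+n\lambda_x}{\Lambda}\right\rfloor$ for $x\in\{b,c,d,e\}$, one has $n=\langle n\rangle_b+\langle n\rangle_c+\langle n\rangle_d+\langle n\rangle_e$ for all integers $n\ge0$. Let $\phi(x;n)$, $H(n)$ and $\Theta(m)$ be as defined in the context. Assume that $\phi(q^n;k)\neq0$ for all integers $n\ge 0$ and $0\le k\le n+1$, that all other denominators occurring below are nonzero, and that the series converges. Then for every integer $\delta$ with $0\le\delta<\Lambda$, $$\frac{(b;q)_\infty(c;q)_\infty(d;q)_\infty(qa^2/bcd;q)_\infty}{(qa/b;q)_\infty(qa/c;q)_\infty(qa/d;q)_\infty(bcd/a;q)_\infty} =\sum_{k=0}^{\delta-1}\Theta(k+1)\left\{\frac{\phi(q^k;k+1)}{-\phi(q^k;k)}\right\}H(k)$$ $$+\sum_{n=1}^{\infty}H(n\Lambda)\,\Theta(n\Lambda)\sum_{j=\delta-\Lambda}^{\delta-1}\frac{\Theta(1+j+n\Lambda)}{\Theta(n\Lambda)}\left\{\frac{\phi(q^{j+n\Lambda};1+j+n\Lambda)}{-\phi(q^{j+n\Lambda};j+n\Lambda)}\right\}\frac{H(j+n\Lamb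da)}{H(n\Lambda)}.$$
   Context: $(x;q)_0=1$, $(x;q)_n=\prod_{j=0}^{n-1}(1-q^jx)$ for $n\ge1$, and $(x;q)_\infty=\prod_{j\ge0}(1-q^jx)$. Expressions such as $a/bc$ mean $a/(bc)$ and $b/ax$ means $b/(ax)$; $\binom m2=m(m-1)/2$; empty sums are $0$. Define $$\phi(x;n)=(bx;q)_{\langle n\rangle_b}(cx;q)_{\langle n\rangle_c}(dx;q)_{\langle n\rangle_d}(qa^2x/bcd;q)_{\langle n\rangle_e}\,(b/ax;q)_{\langle n\rangle_b}(c/ax;q)_{\langle n\rangle_c}(d/ax;q)_{\langle n\rangle_d}(qa/bcdx;q)_{\langle n\rangle_e},$$ $$H(n)=\frac{(b;q)_{\langle n\rangle_b}(c;q)_{\langle n\rangle_c}(d;q)_{\langle n\rangle_d}(qa^2/bcd;q)_{\langle n\rangle_e}}{(q;q)_n\,(bcd/a;q)_{\langle n\rangle_b+\langle n\rangle_c+\langle n\rangle_d}} \cdot\frac{(bc/a;q)_{\langle n\rangle_b+\langle n\rangle_c}(qa/bc;q)_{\langle n\rangle_d+\langle n\rangle_e}}{(qa/b;q)_{\langle n\rangle_c+\langle n\rangle_d+\langle n\rangle_e}}$$ $$\times\frac{(bd/a;q)_{\langle n\rangle_b+\langle n\rangle_d}(qa/bd;q)_{\langle n\rangle_c+\langle n\rangle_e}}{(qa/c;q)_{\langle n\rangle_b+\langle n\rangle_d+\langle n\rangle_e}} \cdot\frac{(cd/a;q)_{\langle n\rangle_c+\langle n\rangle_d}(qa/cd;q)_{\langle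 n\rangle_b+\langle n\rangle_e}}{(qa/d;q)_{\langle n\rangle_b+\langle n\rangle_c+\langle n\rangle_e}},$$ $$\Theta(m)=q^{\binom m2-\binom{\langle m\rangle_b}2-\binom{\langle m\rangle_c}2-\binom{\langle m\rangle_d}2-\binom{\langle m\rangle_e}2}\left(\frac ab\right)^{\langle m\rangle_b}\left(\frac ac\right)^{\langle m\rangle_c}\left(\frac ad\right)^{\langle m\rangle_d}\left(\frac{bcd}{qa}\right)^{\langle m\rangle_e}.$$
   Formalization: "The series converges" is taken as convergence of the series of individual summands, not only of the outer n-series of blocks; with the latter the identity fails, e.g. for λ_b=Λ=2, all ε=0, a=−b, where δ=0 and δ=1 give different values. *)

theory Defs
  imports "HOL-Analysis.Analysis"
begin

definition qpoch :: "complex \<Rightarrow> complex \<Rightarrow> nat \<Rightarrow> complex" where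
  "qpoch x q n = (\<Prod>j<n. 1 - q ^ j * x)"

definition qpoch_inf :: "complex \<Rightarrow> complex \<Rightarrow> complex" where
  "qpoch_inf x q = (\<Prod>j. 1 - q ^ j * x)"

text \<open>
  In the following definitions the arguments \<open>B C D E\<close> are the four splitting functions
  \<open>n \<mapsto> \<langle>n\<rangle>\<^sub>b, \<langle>n\<rangle>\<^sub>c, \<langle>n\<rangle>\<^sub>d, \<langle>n\<rangle>\<^sub>e\<close>.
\<close>

definition phi ::
  "complex \<Rightarrow> complex \<Rightarrow> complex \<Rightarrow> complex \<Rightarrow> complex \<Rightarrow>
   (nat \<Rightarrow> nat) \<Rightarrow> (nat \<Rightarrow> nat) \<Rightarrow> (nat \<Rightarrow> nat) \<Rightarrow> (nat \<Rightarrow> nat) \<Rightarrow> complex \<Rightarrow> nat \<Rightarrow> complex" where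
  "phi q a b c d B C D E x n =
     qpoch (b * x) q (B n) * qpoch (c * x) q (C n) * qpoch (d * x) q (D n)
     * qpoch (q * a\<^sup>2 * x / (b * c * d)) q (E n)
     * qpoch (b / (a * x)) q (B n) * qpoch (c / (a * x)) q (C n) * qpoch (d / (a * x)) q (D n)
     * qpoch (q * a / (b * c * d * x)) q (E n)"

definition H_coeff ::
  "complex \<Rightarrow> complex \<Rightarrow> complex \<Rightarrow> complex \<Rightarrow> complex \<Rightarrow>
   (nat \<Rightarrow> nat) \<Rightarrow> (nat \<Rightarrow> nat) \<Rightarrow> (nat \<Rightarrow> nat) \<Rightarrow> (nat \<Rightarrow> nat) \<Rightarrow> nat \<Rightarrow> complex" where
  "H_coeff q a b c d B C D E n =
     (qpoch b q (B n) * qpoch c q (C n) * qpoch d q (D n) * qpoch (q * a\<^sup>2 / (b * c * d)) q (E n))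
       / (qpoch q q n * qpoch (b * c * d / a) q (B n + C n + D n))
     * ((qpoch (b * c / a) q (B n + C n) * qpoch (q * a / (b * c)) q (D n + E n))
       / qpoch (q * a / b) q (C n + D n + E n))
     * ((qpoch (b * d / a) q (B n + D n) * qpoch (q * a / (b * d)) q (C n + E n))
       / qpoch (q * a / c) q (B n + D n + E n))
     * ((qpoch (c * d / a) q (C n + D n) * qpoch (q * a / (c * d)) q (B n + E n))
       / qpoch (q * a / d) q (B n + C n + E n))"

definition Theta ::
  "complex \<Rightarrow> complex \<Rightarrow> complex \<Rightarrow> complex \<Rightarrow> complex \<Rightarrow>
   (nat \<Rightarrow> nat) \<Rightarrow> (nat \<Rightarrow> nat) \<Rightarrow> (nat \<Rightarrow> nat) \<Rightarrow> (nat \<Rightarrow> nat) \<Rightarrow> nat \<Rightarrow> complex" where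
  "Theta q a b c d B C D E m =
     q powi (int (m choose 2) - int (B m choose 2) - int (C m choose 2)
             - int (D m choose 2) - int (E m choose 2))
     * (a / b) ^ B m * (a / c) ^ C m * (a / d) ^ D m * (b * c * d / (q * a)) ^ E m"

end

theory Submission
  imports Defs
begin

text \<open>
  Put \<open>e = q a\<^sup>2 / (b c d)\<close>, so that \<open>b, c, d, e\<close> play symmetric roles, and \<open>z\<^sub>j = q\<^sup>j + 1 / (a q\<^sup>j)\<close>.
  At \<open>x = q\<^sup>j\<close> the function \<open>\<phi>(x; k)\<close> is a polynomial of degree \<open>k\<close> in \<open>z\<^sub>j\<close>, and \<open>H(k)\<close> is, up to
  powers of \<open>q\<close> and \<open>a\<close>, the divided difference on \<open>z\<^sub>0, \<dots>, z\<^sub>k\<close> of \<open>\<phi>(\<cdot>; k)\<close> times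
  \<open>g(j) = q\<^sup>j (b)\<^sub>j(c)\<^sub>j(d)\<^sub>j(e)\<^sub>j / ((qa/b)\<^sub>j(qa/c)\<^sub>j(qa/d)\<^sub>j(qa/e)\<^sub>j)\<close>; this is Jackson's sum.
  Newton interpolation then expands \<open>g(n)\<close> in the rational functions
  \<open>(z - z\<^sub>0) \<cdots> (z - z\<^bsub>k-1\<^esub>) / \<phi>(\<cdot>; k + 1)\<close>. Both facts are obtained at once from a Pascal-type
  recurrence satisfied by the closed form, which needs no distinctness of the nodes (they
  collide when \<open>a\<close> is a negative power of \<open>q\<close>).

  After division by \<open>q\<^sup>n\<close>, the \<open>k\<close>-th term is \<open>u k * W n k\<close> with \<open>u k\<close> the \<open>k\<close>-th term of the series,
  \<open>W n k \<longlonglongrightarrow> 1\<close> as \<open>n\<close> grows, and \<open>W\<close> uniformly bounded, so Tannery's theorem applies once the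
  series converges absolutely. It does so superexponentially unless some \<open>\<lambda>\<^sub>x\<close> equals \<open>\<Lambda>\<close>; in that
  case the series is essentially geometric with ratio \<open>a/x\<close>, and its convergence together with
  \<open>H(n\<Lambda>) \<noteq> 0\<close> forces \<open>|a/x| < 1\<close>.
\<close>

section \<open>Newton expansion from a Pascal-type recurrence\<close>

text \<open>\<open>D s k\<close> plays the divided difference on the nodes \<open>z s\<close>, ...,
  \<open>z (s + k)\<close>, and the \<open>L k\<close> are the linear factors of the denominators.
  The induction passes from start \<open>Suc s\<close> to start \<open>s\<close>: \<open>rec\<close>
  splits each term in two, and neighbouring halves recombine because \<open>L k\<close> is affine.
  No division by a node difference occurs, so nodes may coincide.\<close>

lemma newton_pascal_expansion:
  fixes D :: "nat \<Rightarrow> nat \<Rightarrow> 'a::field" and z \<alpha> \<beta> :: "nat \<Rightarrow> 'a"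
  defines "L \<equiv> \<lambda>k w. \<alpha> k - \<beta> k * w"
  assumes rec: "\<And>s k. D s (Suc k) * (z (Suc (s + k)) - z s)
                  = L k (z (Suc (s + k))) * D (Suc s) k - L k (z s) * D s k"
    and nz: "\<And>k m. k \<le> m \<Longrightarrow> L k (z m) \<noteq> 0"
  shows "D (s + m) 0 = (\<Sum>k\<le>m. D s k * L k (z (s + k)) * (\<Prod>j<k. z (s + m) - z (s + j))
                          / (\<Prod>j\<le>k. L j (z (s + m))))"
proof (induction m arbitrary: s)
  case 0
  then show ?case using nz[of 0 s] by simp
next
  case (Suc m)
  define x where "x = z (s + Suc m)"
  define \<omega> where "\<omega> = (\<lambda>k. \<Prod>j<k. x - z (Suc s + j))"
  define \<Phi> where "\<Phi> = (\<lambda>k. \<Prod>j\<le>k. L j x)"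
  define f where "f = (\<lambda>k. D s k * L k (z s) * \<omega> k / \<Phi> k)"
  define g where "g = (\<lambda>k. D s (Suc k) * (z (Suc (s + k)) - z s) * \<omega> k / \<Phi> k)"
  have Lx: "L k x \<noteq> 0" if "k \<le> Suc m" for k
    unfolding x_def using nz that by simp
  have \<Phi>0: "\<Phi> k \<noteq> 0" if "k \<le> Suc m" for k
    unfolding \<Phi>_def using Lx that by auto
  have \<omega>_last: "\<omega> (Suc m) = 0"
    by (simp add: \<omega>_def x_def)
  have shift: "(\<Prod>j<Suc k. x - z (s + j)) = (x - z s) * \<omega> k" for k
    unfolding \<omega>_def by (simp only: prod.lessThan_Suc_shift) simp
  have \<omega>_Suc: "\<omega> (Suc k) = \<omega> k * (x - z (Suc (s + k)))" for k
    by (simp add: \<omega>_def)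
  have \<Phi>_Suc: "\<Phi> (Suc k) = \<Phi> k * L (Suc k) x" for k
    by (simp add: \<Phi>_def)
  have "D (s + Suc m) 0 = (\<Sum>k\<le>m. D (Suc s) k * L k (z (Suc s + k)) * \<omega> k / \<Phi> k)"
    using Suc.IH[of "Suc s"] by (simp add: x_def \<omega>_def \<Phi>_def)
  also have "\<dots> = (\<Sum>k\<le>m. f k + g k)"
  proof (rule sum.cong)
    fix k
    have "D (Suc s) k * L k (z (Suc s + k)) = D s k * L k (z s) + D s (Suc k) * (z (Suc (s + k)) - z s)"
      using rec[of s k] by (simp add: algebra_simps)
    then show "D (Suc s) k * L k (z (Suc s + k)) * \<omega> k / \<Phi> k = f k + g k"
      by (simp add: f_def g_def add_divide_distrib distrib_right)
  qed simp
  also have "\<dots> = (\<Sum>k\<le>m. f k) + (\<Sum>k\<le>m. g k)"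
    by (rule sum.distrib)
  \<comment> \<open>A null term is appended at the top, since \<open>\<omega> (Suc m)\<close>
    contains the factor \<open>x - x\<close>; after the index shift \<open>f (Suc k)\<close> meets
    \<open>g k\<close>, and both carry \<open>D s (Suc k)\<close>.\<close>
  also have "(\<Sum>k\<le>m. f k) = f 0 + (\<Sum>k\<le>m. f (Suc k))"
  proof -
    have "(\<Sum>k\<le>m. f k) = (\<Sum>k\<le>Suc m. f k)"
      by (simp add: f_def \<omega>_last)
    then show ?thesis by (simp only: sum.atMost_Suc_shift)
  qed
  also have "f 0 + (\<Sum>k\<le>m. f (Suc k)) + (\<Sum>k\<le>m. g k) = f 0 + (\<Sum>k\<le>m. f (Suc k) + g k)"
    by (simp add: sum.distrib)
  also have "(\<Sum>k\<le>m. f (Suc k) + g k) = (\<Sum>k\<le>m. D s (Suc k) * L (Suc k) (z (s + Suc k))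
      * (\<Prod>j<Suc k. x - z (s + j)) / \<Phi> (Suc k))"
  proof (rule sum.cong)
    fix k assume "k \<in> {..m}"
    then have k: "\<Phi> k \<noteq> 0" "L (Suc k) x \<noteq> 0" using \<Phi>0 Lx by auto
    \<comment> \<open>Linear interpolation of an affine function between \<open>z s\<close> and
      \<open>x\<close>, multiplied out so that \<open>x = z s\<close> is allowed.\<close>
    have affine: "L (Suc k) (z (s + Suc k)) * (x - z s)
        = L (Suc k) (z s) * (x - z (Suc (s + k))) + (z (Suc (s + k)) - z s) * L (Suc k) x"
      by (simp add: L_def algebra_simps)
    have "f (Suc k) + g k = D s (Suc k) * (L (Suc k) (z s) * (x - z (Suc (s + k)))
        + (z (Suc (s + k)) - z s) * L (Suc k) x) * \<omega> k / \<Phi> (Suc k)"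
      using k by (simp add: f_def g_def \<omega>_Suc \<Phi>_Suc field_simps)
    then show "f (Suc k) + g k = D s (Suc k) * L (Suc k) (z (s + Suc k))
        * (\<Prod>j<Suc k. x - z (s + j)) / \<Phi> (Suc k)"
      unfolding shift affine[symmetric] by (simp only: mult.assoc)
  qed simp
  also have "f 0 + \<dots> = (\<Sum>k\<le>Suc m. D s k * L k (z (s + k)) * (\<Prod>j<k. x - z (s + j)) / \<Phi> k)"
    unfolding sum.atMost_Suc_shift by (simp add: f_def \<omega>_def)
  finally show ?case by (simp only: x_def \<Phi>_def)
qed

section \<open>The closed form of the divided differences\<close>

lemma qpoch_0 [simp]: "qpoch x q 0 = 1"
  by (simp add: qpoch_def)

lemma qpoch_Suc: "qpoch x q (Suc n) = qpoch x q n * (1 - q ^ n * x)"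
  by (simp add: qpoch_def)

text \<open>The polynomial core of Jackson's sum, in the variables left once the balancing condition
  is used: \<open>A\<close> is \<open>\<beta> / \<alpha>\<close> below, and \<open>c\<close>,
  \<open>d\<close>, \<open>e\<close> are \<open>\<gamma>\<close>, \<open>\<delta>\<close>,
  \<open>\<eta>\<close>.\<close>

lemma jackson_core_identity:
  fixes A c d e :: "'a::comm_ring_1"
  shows "A * (1 - A\<^sup>2 * c * d * e) * ((1 - c) * (1 - d) * (1 - e))
     + (1 - A) * ((1 - A * d * e) * (1 - A * c * e) * (1 - A * c * d))
     = (1 - A * c) * (1 - A * d) * (1 - A * e) * (1 - A * c * d * e)"
  by (simp add: algebra_simps power2_eq_square)

text \<open>What remains of the recurrence \<open>dd_rec\<close> once common factors are removed:
  \<open>\<beta>\<close> belongs to the parameter whose index grows, \<open>p\<close> is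
  \<open>q ^ Suc n\<close>, and \<open>bal\<close> is the balancing condition.\<close>

lemma jackson_step_identity:
  fixes \<alpha> \<beta> \<gamma> \<delta> \<eta> p :: complex
  assumes nz: "\<alpha> \<noteq> 0" "\<beta> \<noteq> 0" "\<gamma> \<noteq> 0" "\<delta> \<noteq> 0" "\<eta> \<noteq> 0" "p \<noteq> 0"
    and bal: "\<beta> * \<gamma> * \<delta> * \<eta> = p * \<alpha>\<^sup>2"
    and den: "1 - p * \<alpha> / \<beta> \<noteq> 0" "1 - p * \<alpha> / \<gamma> \<noteq> 0" "1 - p * \<alpha> / \<delta> \<noteq> 0" "1 - p * \<alpha> / \<eta> \<noteq> 0"
  shows "(\<alpha> * p - 1) * ((1 - \<beta>) * (1 - \<beta> * \<gamma> / \<alpha>) * (1 - \<beta> * \<delta> / \<alpha>) * (1 - \<beta> * \<eta> / \<alpha>))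
       / ((1 - p * \<alpha> / \<gamma>) * (1 - p * \<alpha> / \<delta>) * (1 - p * \<alpha> / \<eta>))
     = (1 - \<beta> * p) * (1 - \<beta> / (\<alpha> * p)) * p * ((1 - \<beta>) * (1 - \<gamma>) * (1 - \<delta>) * (1 - \<eta>))
       / ((1 - p * \<alpha> / \<beta>) * (1 - p * \<alpha> / \<gamma>) * (1 - p * \<alpha> / \<delta>) * (1 - p * \<alpha> / \<eta>))
       - (1 - \<beta>) * (1 - \<beta> / \<alpha>)"
proof -
  define A where "A = \<beta> / \<alpha>"
  define Q where "Q = (1 - p * \<alpha> / \<gamma>) * (1 - p * \<alpha> / \<delta>) * (1 - p * \<alpha> / \<eta>)"
  have Q0: "Q \<noteq> 0" using den by (simp add: Q_def)
  have p: "p = \<beta> * \<gamma> * \<delta> * \<eta> / \<alpha>\<^sup>2" using bal nz by (simp add: field_simps)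
  have subst: "p * \<alpha> / \<gamma> = A * \<delta> * \<eta>" "p * \<alpha> / \<delta> = A * \<gamma> * \<eta>" "p * \<alpha> / \<eta> = A * \<gamma> * \<delta>"
    "\<beta> * p = A\<^sup>2 * \<gamma> * \<delta> * \<eta>" "\<alpha> * p = A * \<gamma> * \<delta> * \<eta>"
    using nz unfolding p A_def by (simp_all add: field_simps power2_eq_square)
  have core: "A * (1 - \<beta> * p) * ((1 - \<gamma>) * (1 - \<delta>) * (1 - \<eta>)) + (1 - A) * Q
      = (1 - A * \<gamma>) * (1 - A * \<delta>) * (1 - A * \<eta>) * (1 - \<alpha> * p)"
    unfolding Q_def subst by (rule jackson_core_identity)
  \<comment> \<open>This supplies \<open>1 - p * \<alpha> / \<beta>\<close>, the one denominator
    factor on the right that is absent on the left, and so cancels it.\<close>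
  have "(1 - \<beta> / (\<alpha> * p)) * p = - A * (1 - p * \<alpha> / \<beta>)"
    using nz by (simp add: A_def field_simps)
  then have "(1 - \<beta> * p) * (1 - \<beta> / (\<alpha> * p)) * p * ((1 - \<beta>) * (1 - \<gamma>) * (1 - \<delta>) * (1 - \<eta>))
        / ((1 - p * \<alpha> / \<beta>) * (1 - p * \<alpha> / \<gamma>) * (1 - p * \<alpha> / \<delta>) * (1 - p * \<alpha> / \<eta>))
      = ((1 - p * \<alpha> / \<beta>) * (- A * (1 - \<beta> * p) * ((1 - \<beta>) * (1 - \<gamma>) * (1 - \<delta>) * (1 - \<eta>))))
        / ((1 - p * \<alpha> / \<beta>) * Q)"
    by (simp add: Q_def mult.assoc mult.left_commute)
  also have "\<dots> = - A * (1 - \<beta> * p) * ((1 - \<beta>) * (1 - \<gamma>) * (1 - \<delta>) * (1 - \<eta>)) / Q"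
    using den(1) by (rule mult_divide_mult_cancel_left)
  also have "\<dots> - (1 - \<beta>) * (1 - \<beta> / \<alpha>)
      = - (1 - \<beta>) * (A * (1 - \<beta> * p) * ((1 - \<gamma>) * (1 - \<delta>) * (1 - \<eta>)) + (1 - A) * Q) / Q"
  proof -
    have "- A * (1 - \<beta> * p) * ((1 - \<beta>) * (1 - \<gamma>) * (1 - \<delta>) * (1 - \<eta>)) - (1 - \<beta>) * (1 - A) * Q
        = - (1 - \<beta>) * (A * (1 - \<beta> * p) * ((1 - \<gamma>) * (1 - \<delta>) * (1 - \<eta>)) + (1 - A) * Q)"
      by algebra
    then show ?thesis
      using Q0 by (simp only: A_def[symmetric] divide_diff_eq_iff not_False_eq_True)
  qed
  also have "\<dots> = (\<alpha> * p - 1) * ((1 - \<beta>) * (1 - A * \<gamma>) * (1 - A * \<delta>) * (1 - A * \<eta>)) / Q"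
    unfolding core by (simp add: algebra_simps)
  finally show ?thesis by (simp add: A_def Q_def)
qed

text \<open>
  The \<open>k\<close>-th divided difference, on the nodes \<open>z\<^sub>s, \<dots>, z\<^sub>s\<^sub>+\<^sub>k\<close> with
  \<open>z\<^sub>j = q\<^sup>j + 1 / (a q\<^sup>j)\<close>, of the polynomial \<open>\<phi>(\<cdot>; k)\<close> times the function
  \<open>z\<^sub>j \<mapsto> q\<^sup>j (b)\<^sub>j(c)\<^sub>j(d)\<^sub>j(e)\<^sub>j / ((qa/b)\<^sub>j(qa/c)\<^sub>j(qa/d)\<^sub>j(qa/e)\<^sub>j)\<close>.
\<close>

definition dd :: "complex \<Rightarrow> complex \<Rightarrow> complex \<Rightarrow> complex \<Rightarrow> complex \<Rightarrow> complex \<Rightarrow> nat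
    \<Rightarrow> nat \<Rightarrow> nat \<Rightarrow> nat \<Rightarrow> nat \<Rightarrow> complex" where
  "dd q a b c d e s i j k l =
     (- a) ^ (i + j + k + l) * q ^ (s * Suc (i + j + k + l) + (Suc (i + j + k + l) choose 2))
     * (qpoch b q (s + i) * qpoch c q (s + j) * qpoch d q (s + k) * qpoch e q (s + l))
     / (qpoch (q * a / b) q (s + j + k + l) * qpoch (q * a / c) q (s + i + k + l)
        * qpoch (q * a / d) q (s + i + j + l) * qpoch (q * a / e) q (s + i + j + k))
     * (qpoch (b * c / a) q (i + j) * qpoch (b * d / a) q (i + k) * qpoch (b * e / a) q (i + l)
        * qpoch (c * d / a) q (j + k) * qpoch (c * e / a) q (j + l) * qpoch (d * e / a) q (k + l))
     / qpoch q q (i + j + k + l)"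

text \<open>The recurrence \<open>dd_rec\<close> raises only the index attached to \<open>b\<close>;
  these transpositions carry it over to the other three indices.\<close>

lemma dd_swap:
  "dd q a b c d e s i j k l = dd q a c b d e s j i k l"
  "dd q a b c d e s i j k l = dd q a d c b e s k j i l"
  "dd q a b c d e s i j k l = dd q a e c d b s l j k i"
  unfolding dd_def by (simp_all add: mult_ac add_ac)

lemma Suc_choose_2: "Suc n choose 2 = (n choose 2) + n"
  by (simp add: numeral_2_eq_2)

text \<open>Both neighbours of \<open>dd\<close> are explicit multiples of it, so dividing it out
  leaves \<open>jackson_step_identity\<close>. On the nodes \<open>L\<close> factors as
  \<open>(1 - b * q ^ (i + m)) * (1 - b * q ^ i / (a * q ^ m))\<close>, the factor gained by the
  denominator polynomial when \<open>i\<close> grows.\<close>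

lemma dd_rec:
  assumes nz: "q \<noteq> 0" "a \<noteq> 0" "b \<noteq> 0" "c \<noteq> 0" "d \<noteq> 0" "e \<noteq> 0"
    and bal: "b * c * d * e = q * a\<^sup>2"
    and den: "\<And>n. qpoch (q * a / b) q n \<noteq> 0" "\<And>n. qpoch (q * a / c) q n \<noteq> 0"
      "\<And>n. qpoch (q * a / d) q n \<noteq> 0" "\<And>n. qpoch (q * a / e) q n \<noteq> 0" "\<And>n. qpoch q q n \<noteq> 0"
    and n: "n = i + j + k + l"
    and z: "z = (\<lambda>m. q ^ m + 1 / (a * q ^ m))"
    and L: "L = (\<lambda>w. 1 + (b * q ^ i)\<^sup>2 / a - b * q ^ i * w)"
  shows "dd q a b c d e s (Suc i) j k l * (z (Suc (s + n)) - z s)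
     = L (z (Suc (s + n))) * dd q a b c d e (Suc s) i j k l - L (z s) * dd q a b c d e s i j k l"
proof -
  define \<alpha> \<beta> \<gamma> \<delta> \<eta> p where "\<alpha> = a * q ^ s * q ^ s" and "\<beta> = b * q ^ (s + i)"
    and "\<gamma> = c * q ^ (s + j)" and "\<delta> = d * q ^ (s + k)" and "\<eta> = e * q ^ (s + l)" and "p = q ^ Suc n"
  note defs = \<alpha>_def \<beta>_def \<gamma>_def \<delta>_def \<eta>_def p_def
  have nz': "\<alpha> \<noteq> 0" "\<beta> \<noteq> 0" "\<gamma> \<noteq> 0" "\<delta> \<noteq> 0" "\<eta> \<noteq> 0" "p \<noteq> 0"
    using nz by (simp_all add: defs)
  have "\<beta> * \<gamma> * \<delta> * \<eta> = (b * c * d * e) * q ^ (4 * s + n)"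
    by (simp add: defs n power_add mult_ac numeral_eq_Suc)
  also have "\<dots> = p * \<alpha>\<^sup>2"
    unfolding bal by (simp add: defs power_add power2_eq_square mult_ac)
       (simp add: power_mult[symmetric] numeral_eq_Suc power_add mult_ac)
  finally have bal': "\<beta> * \<gamma> * \<delta> * \<eta> = p * \<alpha>\<^sup>2" .
  have fac: "q ^ (s + j + k + l) * (q * a / b) = p * \<alpha> / \<beta>"
    "q ^ (s + i + k + l) * (q * a / c) = p * \<alpha> / \<gamma>"
    "q ^ (s + i + j + l) * (q * a / d) = p * \<alpha> / \<delta>"
    "q ^ (s + i + j + k) * (q * a / e) = p * \<alpha> / \<eta>"
    "q ^ (i + j) * (b * c / a) = \<beta> * \<gamma> / \<alpha>"
    "q ^ (i + k) * (b * d / a) = \<beta> * \<delta> / \<alpha>"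
    "q ^ (i + l) * (b * e / a) = \<beta> * \<eta> / \<alpha>"
    "q ^ (s + i) * b = \<beta>" "q ^ (s + j) * c = \<gamma>" "q ^ (s + k) * d = \<delta>" "q ^ (s + l) * e = \<eta>"
    "q ^ n * q = p"
    using nz by (simp_all add: defs n power_add field_simps)
  have f0: "1 - p * \<alpha> / \<beta> \<noteq> 0" "1 - p * \<alpha> / \<gamma> \<noteq> 0" "1 - p * \<alpha> / \<delta> \<noteq> 0" "1 - p * \<alpha> / \<eta> \<noteq> 0" "1 - p \<noteq> 0"
    using den(1)[of "Suc (s + j + k + l)"] den(2)[of "Suc (s + i + k + l)"]
      den(3)[of "Suc (s + i + j + l)"] den(4)[of "Suc (s + i + j + k)"] den(5)[of "Suc n"]
    unfolding qpoch_Suc fac by simp_all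
  define X where "X = dd q a b c d e s i j k l"
  have s1: "dd q a b c d e (Suc s) i j k l = X * (p * ((1 - \<beta>) * (1 - \<gamma>) * (1 - \<delta>) * (1 - \<eta>))
       / ((1 - p * \<alpha> / \<beta>) * (1 - p * \<alpha> / \<gamma>) * (1 - p * \<alpha> / \<delta>) * (1 - p * \<alpha> / \<eta>)))"
  proof -
    have e: "q ^ (Suc s * Suc n + (Suc n choose 2)) = q ^ (s * Suc n + (Suc n choose 2)) * p"
      by (simp add: p_def power_add mult_ac)
    then show ?thesis
      unfolding X_def dd_def add_Suc qpoch_Suc fac n[symmetric] e by (simp add: mult_ac)
  qed
  have s2: "dd q a b c d e s (Suc i) j k l = X * ((- a) * q ^ (s + Suc n)
       * ((1 - \<beta>) * (1 - \<beta> * \<gamma> / \<alpha>) * (1 - \<beta> * \<delta> / \<alpha>) * (1 - \<beta> * \<eta> / \<alpha>))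
       / ((1 - p * \<alpha> / \<gamma>) * (1 - p * \<alpha> / \<delta>) * (1 - p * \<alpha> / \<eta>) * (1 - p)))"
  proof -
    have e: "q ^ (s * Suc (Suc n) + (Suc (Suc n) choose 2)) = q ^ (s * Suc n + (Suc n choose 2)) * q ^ (s + Suc n)"
      unfolding Suc_choose_2[of "Suc n"] by (simp add: power_add mult_ac)
    then show ?thesis
      unfolding X_def dd_def add_Suc add_Suc_right qpoch_Suc fac n[symmetric] power_Suc[of "- a"] e
      by (simp add: mult_ac)
  qed
  \<comment> \<open>The node difference factorises. Its factor \<open>1 - p\<close> cancels against
    the new factor of \<open>qpoch q q (Suc n)\<close>, while \<open>\<alpha> * p - 1\<close>, which
    vanishes when nodes collide, is never divided by.\<close>
  have zdiff: "(- a) * q ^ (s + Suc n) * (z (Suc (s + n)) - z s) = (1 - p) * (\<alpha> * p - 1)"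
    using nz by (simp add: z defs power_add field_simps)
  have L1: "L (z (Suc (s + n))) = (1 - \<beta> * p) * (1 - \<beta> / (\<alpha> * p))"
    using nz by (simp add: L z defs power_add field_simps power2_eq_square)
  have L2: "L (z s) = (1 - \<beta>) * (1 - \<beta> / \<alpha>)"
    using nz by (simp add: L z defs power_add field_simps power2_eq_square)
  have "dd q a b c d e s (Suc i) j k l * (z (Suc (s + n)) - z s)
     = X * ((- a) * q ^ (s + Suc n) * (z (Suc (s + n)) - z s))
       * ((1 - \<beta>) * (1 - \<beta> * \<gamma> / \<alpha>) * (1 - \<beta> * \<delta> / \<alpha>) * (1 - \<beta> * \<eta> / \<alpha>))
       / ((1 - p * \<alpha> / \<gamma>) * (1 - p * \<alpha> / \<delta>) * (1 - p * \<alpha> / \<eta>) * (1 - p))"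
    unfolding s2 by simp
  also have "\<dots> = X * ((\<alpha> * p - 1) * ((1 - \<beta>) * (1 - \<beta> * \<gamma> / \<alpha>) * (1 - \<beta> * \<delta> / \<alpha>) * (1 - \<beta> * \<eta> / \<alpha>))
       / ((1 - p * \<alpha> / \<gamma>) * (1 - p * \<alpha> / \<delta>) * (1 - p * \<alpha> / \<eta>)))"
    unfolding zdiff using f0(5) by (simp add: mult_ac)
  also have "\<dots> = L (z (Suc (s + n))) * dd q a b c d e (Suc s) i j k l - L (z s) * X"
    unfolding jackson_step_identity[OF nz' bal' f0(1-4)] s1 L1 L2
  proof -
    have "x * (m * m' * y * r / t - v) = m * m' * (x * (y * r / t)) - v * x" for x m m' y r t v :: complex
      by (simp add: algebra_simps)
    then show "X * ((1 - \<beta> * p) * (1 - \<beta> / (\<alpha> * p)) * p * ((1 - \<beta>) * (1 - \<gamma>) * (1 - \<delta>) * (1 - \<eta>))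
       / ((1 - p * \<alpha> / \<beta>) * (1 - p * \<alpha> / \<gamma>) * (1 - p * \<alpha> / \<delta>) * (1 - p * \<alpha> / \<eta>))
       - (1 - \<beta>) * (1 - \<beta> / \<alpha>)) = (1 - \<beta> * p) * (1 - \<beta> / (\<alpha> * p))
       * (X * (p * ((1 - \<beta>) * (1 - \<gamma>) * (1 - \<delta>) * (1 - \<eta>))
       / ((1 - p * \<alpha> / \<beta>) * (1 - p * \<alpha> / \<gamma>) * (1 - p * \<alpha> / \<delta>) * (1 - p * \<alpha> / \<eta>))))
       - (1 - \<beta>) * (1 - \<beta> / \<alpha>) * X" .
  qed
  finally show ?thesis by (simp add: X_def)
qed

section \<open>The finite expansion\<close>

text \<open>A q-shifted factorial read downwards from the exponent \<open>n\<close>. The truncated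
  subtraction agrees with the integer one as long as \<open>m \<le> Suc n\<close>.\<close>

definition qfall :: "complex \<Rightarrow> complex \<Rightarrow> nat \<Rightarrow> nat \<Rightarrow> complex" where
  "qfall x q n m = (\<Prod>j<m. 1 - q ^ (n - j) * x)"

lemma qfall_0 [simp]: "qfall x q n 0 = 1"
  by (simp add: qfall_def)

lemma qfall_Suc: "qfall x q n (Suc m) = qfall x q n m * (1 - q ^ (n - m) * x)"
  by (simp add: qfall_def)

text \<open>Each factor is turned around by pulling out its second term. The argument
  \<open>b / (a * q ^ n)\<close> is unbounded as \<open>n\<close> grows, whereas the reflected
  factors stay bounded.\<close>

lemma qpoch_reflect:
  assumes "q \<noteq> 0" "a \<noteq> 0" "b \<noteq> 0" "m \<le> Suc n"
  shows "qpoch (b / (a * q ^ n)) q m = (- 1) ^ m * q ^ (m choose 2) / ((a / b) ^ m * (q ^ n) ^ m) * qfall (a / b) q n m"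
  using assms(4)
proof (induction m)
  case (Suc m)
  then have "q ^ n = q ^ (n - m) * q ^ m"
    by (simp add: power_add[symmetric])
  then have "1 - q ^ m * (b / (a * q ^ n)) = - (q ^ m / ((a / b) * q ^ n)) * (1 - q ^ (n - m) * (a / b))"
    using assms by (simp add: field_simps)
  then show ?case
    using Suc by (simp add: qpoch_Suc qfall_Suc Suc_choose_2 power_add mult_ac)
qed (simp add: numeral_2_eq_2)

text \<open>Each node difference factors as
  \<open>(1 - q ^ (n - j)) * (1 - a * q ^ (n + j)) / (a * q ^ n)\<close>.\<close>

lemma node_product:
  assumes "q \<noteq> 0" "a \<noteq> 0" "m \<le> n"
  shows "(\<Prod>j<m. (q ^ n + 1 / (a * q ^ n)) - (q ^ j + 1 / (a * q ^ j)))
    = qfall 1 q n m * qpoch (a * q ^ n) q m / (a ^ m * (q ^ n) ^ m)"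
  using assms(3)
proof (induction m)
  case (Suc m)
  then have "q ^ n = q ^ (n - m) * q ^ m"
    by (simp add: power_add[symmetric])
  then have "(q ^ n + 1 / (a * q ^ n)) - (q ^ m + 1 / (a * q ^ m))
     = (1 - q ^ (n - m) * 1) * (1 - q ^ m * (a * q ^ n)) / (a * q ^ n)"
    using assms by (simp add: field_simps)
  then show ?case
    using Suc by (simp add: qpoch_Suc qfall_Suc mult_ac)
qed simp

text \<open>
  The number \<open>\<beta> k\<close> is the parameter of the factor \<open>\<phi>(\<cdot>; k + 1) / \<phi>(\<cdot>; k)\<close>, which is linear in \<open>z\<close>.
\<close>

locale lattice_path =
  fixes q a b c d e :: complex and B C D E :: "nat \<Rightarrow> nat" and \<beta> :: "nat \<Rightarrow> complex"
  assumes q: "q \<noteq> 0" "norm q < 1"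
    and nz: "a \<noteq> 0" "b \<noteq> 0" "c \<noteq> 0" "d \<noteq> 0" "e \<noteq> 0"
    and bal: "b * c * d * e = q * a\<^sup>2"
    and total: "\<And>n. B n + C n + D n + E n = n"
    and step: "\<And>n.
       \<beta> n = b * q ^ B n \<and> B (Suc n) = Suc (B n) \<and> C (Suc n) = C n \<and> D (Suc n) = D n \<and> E (Suc n) = E n \<or>
       \<beta> n = c * q ^ C n \<and> B (Suc n) = B n \<and> C (Suc n) = Suc (C n) \<and> D (Suc n) = D n \<and> E (Suc n) = E n \<or>
       \<beta> n = d * q ^ D n \<and> B (Suc n) = B n \<and> C (Suc n) = C n \<and> D (Suc n) = Suc (D n) \<and> E (Suc n) = E n \<or>
       \<beta> n = e * q ^ E n \<and> B (Suc n) = B n \<and> C (Suc n) = C n \<and> D (Suc n) = D n \<and> E (Suc n) = Suc (E n)"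
    and den: "\<And>n. qpoch (q * a / b) q n \<noteq> 0" "\<And>n. qpoch (q * a / c) q n \<noteq> 0"
      "\<And>n. qpoch (q * a / d) q n \<noteq> 0" "\<And>n. qpoch (q * a / e) q n \<noteq> 0"
begin

text \<open>With \<open>e\<close> available the four parameters enter symmetrically. This and the
  next two definitions restate \<open>phi\<close>, \<open>Theta\<close> and \<open>H_coeff\<close>
  in that form; for example \<open>q * a / (b * c)\<close> becomes \<open>d * e / a\<close>, and
  \<open>b * c * d / a\<close> becomes \<open>q * a / e\<close>.\<close>

definition \<phi> :: "complex \<Rightarrow> nat \<Rightarrow> complex" where
  "\<phi> x n = (qpoch (b * x) q (B n) * qpoch (c * x) q (C n) * qpoch (d * x) q (D n) * qpoch (e * x) q (E n))
     * (qpoch (b / (a * x)) q (B n) * qpoch (c / (a * x)) q (C n)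
        * qpoch (d / (a * x)) q (D n) * qpoch (e / (a * x)) q (E n))"

definition \<Theta> :: "nat \<Rightarrow> complex" where
  "\<Theta> m = q ^ (m choose 2) / (q ^ (B m choose 2) * q ^ (C m choose 2) * q ^ (D m choose 2) * q ^ (E m choose 2))
     * ((a / b) ^ B m * (a / c) ^ C m * (a / d) ^ D m * (a / e) ^ E m)"

definition H :: "nat \<Rightarrow> complex" where
  "H n = (qpoch b q (B n) * qpoch c q (C n) * qpoch d q (D n) * qpoch e q (E n))
     / (qpoch (q * a / b) q (C n + D n + E n) * qpoch (q * a / c) q (B n + D n + E n)
        * qpoch (q * a / d) q (B n + C n + E n) * qpoch (q * a / e) q (B n + C n + D n))
     * (qpoch (b * c / a) q (B n + C n) * qpoch (b * d / a) q (B n + D n) * qpoch (b * e / a) q (B n + E n)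
        * qpoch (c * d / a) q (C n + D n) * qpoch (c * e / a) q (C n + E n) * qpoch (d * e / a) q (D n + E n))
     / qpoch q q n"

definition u :: "nat \<Rightarrow> complex" where
  "u k = \<Theta> (Suc k) * - ((1 - \<beta> k * q ^ k) * (1 - \<beta> k / (a * q ^ k))) * H k"

text \<open>The Newton basis function at the node \<open>n\<close>, that is the product of node
  differences over \<open>\<phi> (q ^ n) (Suc k)\<close>, after \<open>node_product\<close> and
  \<open>qpoch_reflect\<close> have moved the powers of \<open>q\<close>, \<open>a\<close> and the
  parameters into \<open>u k\<close>.\<close>

definition W :: "nat \<Rightarrow> nat \<Rightarrow> complex" where
  "W n k = qfall 1 q n k * qpoch (a * q ^ n) q k
     / ((qpoch (b * q ^ n) q (B (Suc k)) * qpoch (c * q ^ n) q (C (Suc k))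
         * qpoch (d * q ^ n) q (D (Suc k)) * qpoch (e * q ^ n) q (E (Suc k)))
        * (qfall (a / b) q n (B (Suc k)) * qfall (a / c) q n (C (Suc k))
           * qfall (a / d) q n (D (Suc k)) * qfall (a / e) q n (E (Suc k))))"

definition G :: "nat \<Rightarrow> complex" where
  "G n = (qpoch b q n * qpoch c q n * qpoch d q n * qpoch e q n)
     / (qpoch (q * a / b) q n * qpoch (q * a / c) q n * qpoch (q * a / d) q n * qpoch (q * a / e) q n)"

lemma total_0: "B 0 = 0" "C 0 = 0" "D 0 = 0" "E 0 = 0"
  using total[of 0] by auto

lemma \<phi>_0: "\<phi> x 0 = 1"
  by (simp add: \<phi>_def total_0)

lemma \<phi>_Suc: "\<phi> x (Suc k) = \<phi> x k * ((1 - \<beta> k * x) * (1 - \<beta> k / (a * x)))"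
  using step[of k] unfolding \<phi>_def by (elim disjE) (simp_all add: qpoch_Suc mult_ac)

lemma den_q: "qpoch q q n \<noteq> 0"
proof -
  have "q ^ j * q \<noteq> 1" for j
  proof
    assume "q ^ j * q = 1"
    then have "norm q ^ Suc j = 1" by (metis norm_one norm_power power_Suc2)
    moreover have "norm q ^ Suc j < 1" using q power_Suc_less_one[of "norm q" j] by simp
    ultimately show False by simp
  qed
  then show ?thesis unfolding qpoch_def by (auto simp: prod_zero_iff)
qed

text \<open>The Newton expansion from start \<open>0\<close> at node \<open>n\<close>, with
  \<open>dd\<close> taken along the path as divided differences. At order zero \<open>dd\<close> is
  \<open>q ^ n * G n\<close>, and the common factor \<open>q ^ n\<close> drops out at the
  end.\<close>

lemma finite_expansion:
  assumes \<phi>: "\<And>n k. k \<le> Suc n \<Longrightarrow> \<phi> (q ^ n) k \<noteq> 0"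
  shows "G n = (\<Sum>k\<le>n. u k * W n k)"
proof -
  define z where "z = (\<lambda>m. q ^ m + 1 / (a * q ^ m))"
  define L where "L = (\<lambda>k w. (1 + (\<beta> k)\<^sup>2 / a) - \<beta> k * w)"
  define Y where "Y = (\<lambda>s k. dd q a b c d e s (B k) (C k) (D k) (E k))"
  have Lz: "L k (z m) = (1 - \<beta> k * q ^ m) * (1 - \<beta> k / (a * q ^ m))" for k m
    using q nz by (simp add: L_def z_def field_simps power2_eq_square)
  have \<phi>_prod: "\<phi> (q ^ m) k = (\<Prod>j<k. L j (z m))" for m k
    by (induction k) (simp_all add: \<phi>_0 \<phi>_Suc Lz)
  have L0: "L k (z m) \<noteq> 0" if "k \<le> m" for k m
    using \<phi>[of "Suc k" m] that by (auto simp: \<phi>_prod)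
  have rec: "Y s (Suc k) * (z (Suc (s + k)) - z s)
      = L k (z (Suc (s + k))) * Y (Suc s) k - L k (z s) * Y s k" for s k
  proof -
    have "c * b * d * e = q * a\<^sup>2" "d * c * b * e = q * a\<^sup>2" "e * c * d * b = q * a\<^sup>2"
      using bal by (simp_all add: mult_ac)
    \<comment> \<open>One instance for each possible direction of the path, obtained by exchanging
      \<open>b\<close> with the parameter whose index grows.\<close>
    note dd_rec_all =
      dd_rec[OF q(1) nz(1) nz(2) nz(3) nz(4) nz(5) bal den(1) den(2) den(3) den(4) den_q _ z_def refl]
      dd_rec[OF q(1) nz(1) nz(3) nz(2) nz(4) nz(5) this(1) den(2) den(1) den(3) den(4) den_q _ z_def refl]
      dd_rec[OF q(1) nz(1) nz(4) nz(3) nz(2) nz(5) this(2) den(3) den(2) den(1) den(4) den_q _ z_def refl]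
      dd_rec[OF q(1) nz(1) nz(5) nz(3) nz(4) nz(2) this(3) den(4) den(2) den(3) den(1) den_q _ z_def refl]
    have k: "k = B k + C k + D k + E k" "k = C k + B k + D k + E k"
      "k = D k + C k + B k + E k" "k = E k + C k + D k + B k"
      using total[of k] by simp_all
    from step[of k] show ?thesis
    proof (elim disjE conjE)
      assume "\<beta> k = b * q ^ B k" "B (Suc k) = Suc (B k)" "C (Suc k) = C k" "D (Suc k) = D k" "E (Suc k) = E k"
      with dd_rec_all(1)[OF k(1), of s] show ?thesis by (simp add: Y_def L_def)
    next
      assume "\<beta> k = c * q ^ C k" "B (Suc k) = B k" "C (Suc k) = Suc (C k)" "D (Suc k) = D k" "E (Suc k) = E k"
      with dd_rec_all(2)[OF k(2), of s] show ?thesis by (simp add: Y_def L_def dd_swap(1)[of q a b])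
    next
      assume "\<beta> k = d * q ^ D k" "B (Suc k) = B k" "C (Suc k) = C k" "D (Suc k) = Suc (D k)" "E (Suc k) = E k"
      with dd_rec_all(3)[OF k(3), of s] show ?thesis by (simp add: Y_def L_def dd_swap(2)[of q a b])
    next
      assume "\<beta> k = e * q ^ E k" "B (Suc k) = B k" "C (Suc k) = C k" "D (Suc k) = D k" "E (Suc k) = Suc (E k)"
      with dd_rec_all(4)[OF k(4), of s] show ?thesis by (simp add: Y_def L_def dd_swap(3)[of q a b])
    qed
  qed
  have "Y (0 + n) 0 = (\<Sum>k\<le>n. Y 0 k * L k (z (0 + k)) * (\<Prod>j<k. z (0 + n) - z (0 + j))
                          / (\<Prod>j\<le>k. L j (z (0 + n))))"
    using rec L0 unfolding L_def by (intro newton_pascal_expansion)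
  moreover have "Y n 0 = q ^ n * G n"
    by (simp add: Y_def dd_def G_def total_0 numeral_2_eq_2)
  moreover have "Y 0 k * L k (z k) * (\<Prod>j<k. z n - z j) / (\<Prod>j\<le>k. L j (z n)) = q ^ n * (u k * W n k)"
    if k: "k \<le> n" for k
  proof -
    define i1 i2 i3 i4 where "i1 = B (Suc k)" and "i2 = C (Suc k)" and "i3 = D (Suc k)" and "i4 = E (Suc k)"
    have sum: "Suc k = i1 + i2 + i3 + i4"
      using total[of "Suc k"] by (simp add: i1_def i2_def i3_def i4_def)
    have split_pow: "x ^ Suc k = x ^ i1 * x ^ i2 * x ^ i3 * x ^ i4" for x :: complex
      by (simp only: sum power_add)
    have le: "i1 \<le> Suc n" "i2 \<le> Suc n" "i3 \<le> Suc n" "i4 \<le> Suc n" using sum k by simp_all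
    have Y: "Y 0 k = (- a) ^ k * q ^ (Suc k choose 2) * H k"
      using total[of k] by (simp add: Y_def dd_def H_def add_ac)
    have "(\<Prod>j\<le>k. L j (z n)) = \<phi> (q ^ n) (Suc k)"
      by (simp add: \<phi>_prod lessThan_Suc_atMost)
    also have "\<dots> = (qpoch (b * q ^ n) q i1 * qpoch (c * q ^ n) q i2 * qpoch (d * q ^ n) q i3 * qpoch (e * q ^ n) q i4)
      * ((- 1) ^ Suc k * (q ^ (i1 choose 2) * q ^ (i2 choose 2) * q ^ (i3 choose 2) * q ^ (i4 choose 2))
        / (((a / b) ^ i1 * (a / c) ^ i2 * (a / d) ^ i3 * (a / e) ^ i4) * (q ^ n) ^ Suc k)
        * (qfall (a / b) q n i1 * qfall (a / c) q n i2 * qfall (a / d) q n i3 * qfall (a / e) q n i4))"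
      unfolding \<phi>_def i1_def[symmetric] i2_def[symmetric] i3_def[symmetric] i4_def[symmetric]
        qpoch_reflect[OF q(1) nz(1) nz(2) le(1)] qpoch_reflect[OF q(1) nz(1) nz(3) le(2)]
        qpoch_reflect[OF q(1) nz(1) nz(4) le(3)] qpoch_reflect[OF q(1) nz(1) nz(5) le(4)]
        split_pow
      by (simp add: mult_ac)
    finally have \<Phi>: "(\<Prod>j\<le>k. L j (z n)) = \<dots>" .
    have T: "\<Theta> (Suc k) = q ^ (Suc k choose 2)
        / (q ^ (i1 choose 2) * q ^ (i2 choose 2) * q ^ (i3 choose 2) * q ^ (i4 choose 2))
        * ((a / b) ^ i1 * (a / c) ^ i2 * (a / d) ^ i3 * (a / e) ^ i4)"
      by (simp only: \<Theta>_def i1_def i2_def i3_def i4_def)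
    have N: "(\<Prod>j<k. z n - z j) = qfall 1 q n k * qpoch (a * q ^ n) q k / (a ^ k * (q ^ n) ^ k)"
      unfolding z_def by (rule node_product[OF q(1) nz(1) k])
    \<comment> \<open>Bookkeeping of signs and powers, with \<open>s\<close>, \<open>ak\<close>,
      \<open>x\<close> for \<open>(- 1) ^ k\<close>, \<open>a ^ k\<close>, \<open>q ^ n\<close>. If
      \<open>P1\<close> or \<open>P2\<close> is zero, both sides are zero because division by zero
      yields zero.\<close>
    have "s * ak * QK * Hk * L1 * (N / (ak * x ^ k)) / (P1 * ((- 1 * s) * Q / (R * x ^ Suc k) * P2))
       = x * (QK / Q * R * - L1 * Hk * (N / (P1 * P2)))"
      if "s \<noteq> 0" "ak \<noteq> 0" "x \<noteq> 0" "Q \<noteq> 0" "R \<noteq> 0"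
      for s ak QK Hk L1 N x P1 P2 Q R :: complex
      using that by (cases "P1 = 0 \<or> P2 = 0") (auto simp: field_simps)
    note cancel = this[of "(- 1) ^ k" "a ^ k" "q ^ n"]
    show ?thesis
      unfolding \<Phi> unfolding Y N u_def W_def Lz T i1_def[symmetric] i2_def[symmetric] i3_def[symmetric] i4_def[symmetric]
        power_minus[of a] power_Suc[of "- 1"]
      by (rule cancel) (use q nz in simp_all)
  qed
  ultimately have "q ^ n * G n = q ^ n * (\<Sum>k\<le>n. u k * W n k)"
    by (simp add: sum_distrib_left)
  then show ?thesis using q by simp
qed

end

section \<open>Bounds and limits of q-shifted factorials\<close>

text \<open>Each factor is at most \<open>exp (norm q ^ j * r)\<close>, and the exponents form a
  geometric series; the bound is uniform in \<open>n\<close> and over the disc.\<close>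

lemma qpoch_bounded:
  assumes "norm q < 1"
  shows "\<exists>M>0. \<forall>n y. norm y \<le> r \<longrightarrow> norm (qpoch y q n) \<le> M"
proof (intro exI conjI allI impI)
  fix n and y :: complex assume y: "norm y \<le> r"
  have r: "0 \<le> r" using y norm_ge_zero order_trans by blast
  have "norm (qpoch y q n) = (\<Prod>j<n. norm (1 - q ^ j * y))"
    by (simp add: qpoch_def prod_norm)
  also have "\<dots> \<le> (\<Prod>j<n. exp (norm q ^ j * r))"
  proof (rule prod_mono, intro conjI)
    fix j
    have "norm (1 - q ^ j * y) \<le> 1 + norm q ^ j * norm y"
      using norm_triangle_ineq4[of 1 "q ^ j * y"] by (simp add: norm_mult norm_power)
    also have "\<dots> \<le> 1 + norm q ^ j * r" using y by (simp add: mult_left_mono)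
    also have "\<dots> \<le> exp (norm q ^ j * r)" by (rule exp_ge_add_one_self)
    finally show "norm (1 - q ^ j * y) \<le> exp (norm q ^ j * r)" .
  qed simp
  also have "\<dots> = exp ((\<Sum>j<n. norm q ^ j) * r)"
    by (simp add: exp_sum sum_distrib_right)
  also have "(\<Sum>j<n. norm q ^ j) \<le> 1 / (1 - norm q)"
    using assms by (subst suminf_geometric[symmetric]) (auto intro!: sum_le_suminf)
  then have "exp ((\<Sum>j<n. norm q ^ j) * r) \<le> exp (1 / (1 - norm q) * r)"
    using r mult_right_mono[of _ _ r] by (simp only: exp_le_cancel_iff)
  finally show "norm (qpoch y q n) \<le> exp (1 / (1 - norm q) * r)" .
qed simp

text \<open>Weierstrass' product inequality: the threshold on \<open>norm y\<close> makes the sum of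
  the terms \<open>norm q ^ j * norm y\<close> at most \<open>1 / 2\<close>.\<close>

lemma qpoch_ge_half:
  assumes "norm q < 1" "norm y \<le> (1 - norm q) / 2"
  shows "1 / 2 \<le> norm (qpoch y q n)"
proof -
  have y1: "norm y \<le> 1"
    using assms(2) norm_ge_zero[of q] by (simp add: field_simps del: norm_ge_zero)
  have "(\<Sum>j<n. norm q ^ j) \<le> 1 / (1 - norm q)"
    using assms by (subst suminf_geometric[symmetric]) (auto intro!: sum_le_suminf)
  then have "(\<Sum>j<n. norm q ^ j) * norm y \<le> 1 / (1 - norm q) * ((1 - norm q) / 2)"
    using assms by (intro mult_mono) auto
  also have "\<dots> = 1 / 2" using assms by simp
  finally have "1 / 2 \<le> 1 - (\<Sum>j<n. norm q ^ j * norm y)"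
    by (simp add: sum_distrib_right)
  also have "\<dots> \<le> (\<Prod>j<n. 1 - norm q ^ j * norm y)"
    using assms y1 by (intro Weierstrass_prod_ineq) (auto intro!: mult_le_one power_le_one)
  also have "\<dots> \<le> (\<Prod>j<n. norm (1 - q ^ j * y))"
  proof (rule prod_mono, intro conjI)
    fix j
    show "0 \<le> 1 - norm q ^ j * norm y"
      using assms y1 by (auto intro!: mult_le_one power_le_one)
    show "1 - norm q ^ j * norm y \<le> norm (1 - q ^ j * y)"
      using norm_triangle_ineq2[of 1 "q ^ j * y"] by (simp add: norm_mult norm_power)
  qed
  also have "\<dots> = norm (qpoch y q n)"
    by (simp add: qpoch_def prod_norm)
  finally show ?thesis .
qed

lemma qpoch_eq_0_mono: "qpoch x q m = 0 \<Longrightarrow> m \<le> n \<Longrightarrow> qpoch x q n = 0"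
  by (auto simp: qpoch_def)

lemma convergent_prod_qpoch:
  fixes q x :: complex
  assumes "norm q < 1"
  shows "convergent_prod (\<lambda>j. 1 - q ^ j * x)"
proof (rule abs_convergent_prod_imp_convergent_prod)
  have "summable (\<lambda>j. norm q ^ j * norm x)"
    using assms by (intro summable_mult2 summable_geometric) simp
  then show "abs_convergent_prod (\<lambda>j. 1 - q ^ j * x)"
    by (simp add: abs_convergent_prod_conv_summable norm_mult norm_power)
qed

lemma qpoch_tendsto:
  assumes "norm q < 1"
  shows "(\<lambda>n. qpoch x q n) \<longlonglongrightarrow> qpoch_inf x q"
proof -
  have "(\<lambda>n. qpoch x q (Suc n)) \<longlonglongrightarrow> qpoch_inf x q"
    using convergent_prod_LIMSEQ[OF convergent_prod_qpoch[OF assms, of x]]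
    by (simp add: qpoch_def qpoch_inf_def lessThan_Suc_atMost)
  then show ?thesis by (rule LIMSEQ_imp_Suc)
qed

lemma qpoch_nonzero:
  assumes "norm q < 1" "qpoch_inf x q \<noteq> 0"
  shows "qpoch x q n \<noteq> 0"
proof
  assume "qpoch x q n = 0"
  then have "eventually (\<lambda>m. qpoch x q m = 0) sequentially"
    using qpoch_eq_0_mono unfolding eventually_sequentially by blast
  then have "(\<lambda>m. qpoch x q m) \<longlonglongrightarrow> 0" by (rule tendsto_eventually)
  with qpoch_tendsto[OF assms(1), of x] assms(2) show False
    using LIMSEQ_unique by blast
qed

text \<open>A convergent product without zero factors has a nonzero limit, so the inverses of its
  partial products are bounded.\<close>

lemma qpoch_lower:
  assumes "norm q < 1" and nz: "\<And>n. qpoch x q n \<noteq> 0"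
  shows "\<exists>c>0. \<forall>n. c \<le> norm (qpoch x q n)"
proof -
  have "1 - q ^ j * x \<noteq> 0" for j
    using nz[of "Suc j"] by (simp add: qpoch_Suc)
  then have "qpoch_inf x q \<noteq> 0"
    unfolding qpoch_inf_def by (intro prodinf_nonzero convergent_prod_qpoch assms) simp
  then have "Bseq (\<lambda>n. inverse (qpoch x q n))"
    using qpoch_tendsto[OF assms(1)] by (intro Bfun_inverse)
  then obtain K where K: "K > 0" "\<And>n. norm (inverse (qpoch x q n)) \<le> K"
    unfolding Bseq_def by blast
  have "inverse K \<le> norm (qpoch x q n)" for n
    using le_imp_inverse_le[OF K(2)[of n]] nz[of n] by (simp add: norm_inverse)
  with K(1) show ?thesis by (meson positive_imp_inverse_positive)
qed

text \<open>Nonvanishing is known only at the indices that a path visits. If these are bounded,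
  finitely many values occur; if not, every partial product is nonzero, since a zero
  persists.\<close>

lemma qpoch_lower_mono:
  fixes f :: "nat \<Rightarrow> nat"
  assumes "norm q < 1" "mono f" and nz: "\<And>n. qpoch x q (f n) \<noteq> 0"
  shows "\<exists>c>0. \<forall>n. c \<le> norm (qpoch x q (f n))"
proof (cases "finite (range f)")
  case True
  let ?S = "(\<lambda>m. norm (qpoch x q m)) ` range f"
  have "finite ?S" "?S \<noteq> {}" using True by auto
  then have "Min ?S > 0" "\<forall>n. Min ?S \<le> norm (qpoch x q (f n))"
    using nz by (auto simp: Min_gr_iff)
  then show ?thesis by blast
next
  case False
  have "qpoch x q m \<noteq> 0" for m
  proof -
    obtain n where "m \<le> f n"
      using False by (metis finite_nat_set_iff_bounded_le nat_le_linear rangeE)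
    then show ?thesis using nz[of n] qpoch_eq_0_mono by blast
  qed
  then show ?thesis using qpoch_lower[OF assms(1)] by blast
qed

lemma qfall_qpoch:
  assumes "m \<le> n"
  shows "qfall x q n m * qpoch (q * x) q (n - m) = qpoch (q * x) q n"
  using assms
proof (induction m)
  case (Suc m)
  then have n: "n - m = Suc (n - Suc m)" by simp
  have "qpoch (q * x) q (n - m) = qpoch (q * x) q (n - Suc m) * (1 - q ^ (n - m) * x)"
    unfolding n qpoch_Suc by (simp add: mult_ac)
  then show ?case using Suc by (simp add: qfall_Suc mult_ac)
qed simp

lemma qfall_upper:
  assumes "norm q < 1" and nz: "\<And>n. qpoch (q * x) q n \<noteq> 0"
  shows "\<exists>M>0. \<forall>n m. m \<le> n \<longrightarrow> norm (qfall x q n m) \<le> M"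
proof -
  obtain M where M: "M > 0" "\<And>n. norm (qpoch (q * x) q n) \<le> M"
    using qpoch_bounded[OF assms(1), of "norm (q * x)"] by blast
  obtain c where c: "c > 0" "\<And>n. c \<le> norm (qpoch (q * x) q n)"
    using qpoch_lower[OF assms] by blast
  have "norm (qfall x q n m) \<le> M / c" if "m \<le> n" for n m
  proof -
    have "norm (qfall x q n m) * c \<le> norm (qfall x q n m) * norm (qpoch (q * x) q (n - m))"
      using c by (intro mult_left_mono) auto
    also have "\<dots> \<le> M"
      using M(2)[of n] unfolding qfall_qpoch[OF that, symmetric] by (simp add: norm_mult)
    finally show ?thesis using c by (simp add: field_simps)
  qed
  then show ?thesis using M c by (intro exI[of _ "M / c"]) auto
qed

text \<open>For \<open>m \<le> n\<close> this is a quotient of two q-shifted factorials, by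
  \<open>qfall_qpoch\<close>. The case \<open>m = Suc n\<close> is included because
  \<open>W n n\<close> contains indices such as \<open>B (Suc n)\<close>.\<close>

lemma qfall_lower:
  assumes "norm q < 1" and nz: "\<And>n. qpoch (q * x) q n \<noteq> 0"
  shows "\<exists>c>0. \<forall>n m. m \<le> Suc n \<longrightarrow> qfall x q n m \<noteq> 0 \<longrightarrow> c \<le> norm (qfall x q n m)"
proof -
  obtain M where M: "M > 0" "\<And>n. norm (qpoch (q * x) q n) \<le> M"
    using qpoch_bounded[OF assms(1), of "norm (q * x)"] by blast
  obtain c where c: "c > 0" "\<And>n. c \<le> norm (qpoch (q * x) q n)"
    using qpoch_lower[OF assms] by blast
  have 1: "c / M \<le> norm (qfall x q n m)" if "m \<le> n" for n m
  proof -
    have "c \<le> norm (qfall x q n m) * norm (qpoch (q * x) q (n - m))"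
      using c(2)[of n] unfolding qfall_qpoch[OF that, symmetric] by (simp add: norm_mult)
    also have "\<dots> \<le> norm (qfall x q n m) * M"
      using M by (intro mult_left_mono) auto
    finally show ?thesis using M by (simp add: field_simps)
  qed
  \<comment> \<open>\<open>\<kappa>\<close> accounts for the extra factor \<open>1 - x\<close> at
    \<open>m = Suc n\<close>. For \<open>x = 1\<close> that factor is zero and the case is excluded,
    so any positive value serves.\<close>
  define \<kappa> where "\<kappa> = (if x = 1 then 1 else min 1 (norm (1 - x)))"
  have \<kappa>: "\<kappa> > 0" "\<kappa> \<le> 1" by (auto simp: \<kappa>_def)
  have "c / M * \<kappa> \<le> norm (qfall x q n m)" if m: "m \<le> Suc n" and nz: "qfall x q n m \<noteq> 0" for n m
  proof (cases "m = Suc n")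
    case True
    then have x: "x \<noteq> 1" using nz by (auto simp: qfall_Suc)
    have "c / M * \<kappa> \<le> norm (qfall x q n n) * norm (1 - x)"
      using 1[of n n] x \<kappa> by (intro mult_mono) (auto simp: \<kappa>_def)
    then show ?thesis by (simp add: True qfall_Suc norm_mult)
  next
    case False
    have "c / M * \<kappa> \<le> c / M" using c M \<kappa> by (simp add: divide_right_mono mult_left_le)
    with 1[of m n] m False show ?thesis by simp
  qed
  then show ?thesis using c M \<kappa> by (intro exI[of _ "c / M * \<kappa>"]) auto
qed

lemma qfall_tendsto:
  assumes "norm q < 1"
  shows "(\<lambda>n. qfall x q n m) \<longlonglongrightarrow> 1"
proof -
  have "(\<lambda>n. q ^ (n - j)) \<longlonglongrightarrow> 0" for j
    using filterlim_compose[OF LIMSEQ_power_zero[OF assms] filterlim_minus_const_nat_at_top[of j]] by simp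
  then have "(\<lambda>n. \<Prod>j<m. 1 - q ^ (n - j) * x) \<longlonglongrightarrow> (\<Prod>j<m. 1 - 0 * x)"
    by (intro tendsto_intros)
  then show ?thesis by (simp add: qfall_def)
qed

lemma qpoch_shift_tendsto:
  assumes "norm q < 1"
  shows "(\<lambda>n. qpoch (x * q ^ n) q m) \<longlonglongrightarrow> 1"
proof -
  have "(\<lambda>n. \<Prod>j<m. 1 - q ^ j * (x * q ^ n)) \<longlonglongrightarrow> (\<Prod>j<m. 1 - q ^ j * (x * 0))"
    by (intro tendsto_intros LIMSEQ_power_zero assms)
  then show ?thesis by (simp add: qpoch_def)
qed

section \<open>Passage to the limit\<close>

context lattice_path
begin

lemma mono_path: "mono B" "mono C" "mono D" "mono E"
  using step by (auto intro!: incseq_SucI) (metis order_refl lessI less_imp_le)+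

lemma mono_path_add:
  "mono (\<lambda>n. B n + C n)" "mono (\<lambda>n. B n + D n)" "mono (\<lambda>n. B n + E n)"
  "mono (\<lambda>n. C n + D n)" "mono (\<lambda>n. C n + E n)" "mono (\<lambda>n. D n + E n)"
  using mono_path unfolding mono_def by (auto intro!: add_mono)

lemma path_le: "B n \<le> n" "C n \<le> n" "D n \<le> n" "E n \<le> n"
  using total[of n] by simp_all

lemma W_tendsto: "(\<lambda>n. W n k) \<longlonglongrightarrow> 1"
proof -
  have "(\<lambda>n. W n k) \<longlonglongrightarrow> 1 * 1 / ((1 * 1 * 1 * 1) * (1 * 1 * 1 * 1))"
    unfolding W_def
    by (intro tendsto_divide tendsto_mult qfall_tendsto qpoch_shift_tendsto q) simp
  then show ?thesis by simp
qed

lemma G_tendsto: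
  assumes "qpoch_inf (q * a / b) q \<noteq> 0" "qpoch_inf (q * a / c) q \<noteq> 0"
    "qpoch_inf (q * a / d) q \<noteq> 0" "qpoch_inf (q * a / e) q \<noteq> 0"
  shows "G \<longlonglongrightarrow> (qpoch_inf b q * qpoch_inf c q * qpoch_inf d q * qpoch_inf e q)
     / (qpoch_inf (q * a / b) q * qpoch_inf (q * a / c) q * qpoch_inf (q * a / d) q * qpoch_inf (q * a / e) q)"
  unfolding G_def
  using assms by (intro tendsto_divide tendsto_mult qpoch_tendsto q) simp

lemma qfall_nonzero:
  assumes \<phi>: "\<phi> (q ^ n) (Suc k) \<noteq> 0" and k: "k \<le> n"
  shows "qfall (a / b) q n (B (Suc k)) \<noteq> 0" "qfall (a / c) q n (C (Suc k)) \<noteq> 0"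
    "qfall (a / d) q n (D (Suc k)) \<noteq> 0" "qfall (a / e) q n (E (Suc k)) \<noteq> 0"
proof -
  have le: "B (Suc k) \<le> Suc n" "C (Suc k) \<le> Suc n" "D (Suc k) \<le> Suc n" "E (Suc k) \<le> Suc n"
    using path_le[of "Suc k"] k by auto
  have "qpoch (b / (a * q ^ n)) q (B (Suc k)) \<noteq> 0" "qpoch (c / (a * q ^ n)) q (C (Suc k)) \<noteq> 0"
    "qpoch (d / (a * q ^ n)) q (D (Suc k)) \<noteq> 0" "qpoch (e / (a * q ^ n)) q (E (Suc k)) \<noteq> 0"
    using \<phi> by (auto simp: \<phi>_def)
  then show "qfall (a / b) q n (B (Suc k)) \<noteq> 0" "qfall (a / c) q n (C (Suc k)) \<noteq> 0"
    "qfall (a / d) q n (D (Suc k)) \<noteq> 0" "qfall (a / e) q n (E (Suc k)) \<noteq> 0"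
    unfolding qpoch_reflect[OF q(1) nz(1) nz(2) le(1)] qpoch_reflect[OF q(1) nz(1) nz(3) le(2)]
      qpoch_reflect[OF q(1) nz(1) nz(4) le(3)] qpoch_reflect[OF q(1) nz(1) nz(5) le(4)]
    by auto
qed

text \<open>The domination for Tannery's theorem. Of the two groups in the denominator, the first is
  bounded below by \<open>qpoch_ge_half\<close> once \<open>n\<close> is large, the second by
  \<open>qfall_lower\<close>, whose nonvanishing premise comes from \<open>\<phi>\<close>.\<close>

lemma W_bounded:
  assumes \<phi>: "\<And>n k. k \<le> Suc n \<Longrightarrow> \<phi> (q ^ n) k \<noteq> 0"
  shows "\<exists>M N. \<forall>n\<ge>N. \<forall>k\<le>n. norm (W n k) \<le> M"
proof -
  obtain M1 where M1: "M1 > 0" "\<And>n m. m \<le> n \<Longrightarrow> norm (qfall 1 q n m) \<le> M1"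
    using qfall_upper[of q 1] q den_q by auto
  obtain M2 where M2: "M2 > 0" "\<And>n y. norm y \<le> norm a \<Longrightarrow> norm (qpoch y q n) \<le> M2"
    using qpoch_bounded[OF q(2)] by blast
  have lower: "\<exists>c>0. \<forall>n m. m \<le> Suc n \<longrightarrow> qfall (a / x) q n m \<noteq> 0 \<longrightarrow> c \<le> norm (qfall (a / x) q n m)"
    if "\<And>n. qpoch (q * a / x) q n \<noteq> 0" for x
    using qfall_lower[OF q(2), of "a / x"] that by simp
  obtain cb where cb: "cb > 0" "\<And>n m. m \<le> Suc n \<Longrightarrow> qfall (a / b) q n m \<noteq> 0 \<Longrightarrow> cb \<le> norm (qfall (a / b) q n m)"
    using lower[OF den(1)] by blast
  obtain cc where cc: "cc > 0" "\<And>n m. m \<le> Suc n \<Longrightarrow> qfall (a / c) q n m \<noteq> 0 \<Longrightarrow> cc \<le> norm (qfall (a / c) q n m)"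
    using lower[OF den(2)] by blast
  obtain cd where cd: "cd > 0" "\<And>n m. m \<le> Suc n \<Longrightarrow> qfall (a / d) q n m \<noteq> 0 \<Longrightarrow> cd \<le> norm (qfall (a / d) q n m)"
    using lower[OF den(3)] by blast
  obtain ce where ce: "ce > 0" "\<And>n m. m \<le> Suc n \<Longrightarrow> qfall (a / e) q n m \<noteq> 0 \<Longrightarrow> ce \<le> norm (qfall (a / e) q n m)"
    using lower[OF den(4)] by blast
  have "eventually (\<lambda>n. norm (x * q ^ n) \<le> (1 - norm q) / 2) sequentially" for x
  proof -
    have "(\<lambda>n. norm (x * q ^ n)) \<longlonglongrightarrow> norm (x * 0)"
      by (intro tendsto_intros LIMSEQ_power_zero q(2))
    then show ?thesis
      using q(2) by (intro eventually_mono[OF order_tendstoD(2)[of _ 0 _ "(1 - norm q) / 2"]]) auto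
  qed
  then have "eventually (\<lambda>n. norm (b * q ^ n) \<le> (1 - norm q) / 2 \<and> norm (c * q ^ n) \<le> (1 - norm q) / 2
      \<and> norm (d * q ^ n) \<le> (1 - norm q) / 2 \<and> norm (e * q ^ n) \<le> (1 - norm q) / 2) sequentially"
    by (intro eventually_conj)
  then obtain N where N: "\<And>n. n \<ge> N \<Longrightarrow> norm (b * q ^ n) \<le> (1 - norm q) / 2 \<and> norm (c * q ^ n) \<le> (1 - norm q) / 2
      \<and> norm (d * q ^ n) \<le> (1 - norm q) / 2 \<and> norm (e * q ^ n) \<le> (1 - norm q) / 2"
    by (auto simp: eventually_sequentially)
  have "norm (W n k) \<le> M1 * M2 / ((1/2 * (1/2) * (1/2) * (1/2)) * (cb * cc * cd * ce))"
    if n: "n \<ge> N" and k: "k \<le> n" for n k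
  proof -
    have le: "B (Suc k) \<le> Suc n" "C (Suc k) \<le> Suc n" "D (Suc k) \<le> Suc n" "E (Suc k) \<le> Suc n"
      using path_le[of "Suc k"] k by auto
    note nzf = qfall_nonzero[OF \<phi>[of "Suc k" n] k]
    have aq: "norm (a * q ^ n) \<le> norm a"
      using q by (simp add: norm_mult norm_power mult_left_le power_le_one)
    show ?thesis
      unfolding W_def norm_divide norm_mult
      using n k N[OF n] cb(1) cc(1) cd(1) ce(1) M1(1) M2(1)
      by (intro frac_le mult_mono M1(2) M2(2) aq qpoch_ge_half q cb(2) cc(2) cd(2) ce(2) nzf le)
         (auto intro!: mult_nonneg_nonneg)
  qed
  then show ?thesis by blast
qed

section \<open>Size of the coefficients and absolute convergence\<close>

definition ratio :: "nat \<Rightarrow> complex" where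
  "ratio k = q ^ k * a / \<beta> k"

lemma \<beta>_cases: "\<beta> k = b * q ^ B k \<or> \<beta> k = c * q ^ C k \<or> \<beta> k = d * q ^ D k \<or> \<beta> k = e * q ^ E k"
  using step[of k] by blast

lemma \<beta>_nonzero: "\<beta> k \<noteq> 0"
  using \<beta>_cases[of k] q nz by auto

lemma \<Theta>_0: "\<Theta> 0 = 1"
  by (simp add: \<Theta>_def total_0 numeral_2_eq_2)

lemma \<Theta>_Suc: "\<Theta> (Suc k) = \<Theta> k * ratio k"
  using step[of k] unfolding \<Theta>_def ratio_def
  by (elim disjE conjE) (simp_all add: Suc_choose_2 power_add mult_ac)

text \<open>Since \<open>\<beta> k / (a * q ^ k)\<close> is the inverse of \<open>ratio k\<close>,
  one factor of \<open>\<Theta> (Suc k)\<close> absorbs it; what multiplies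
  \<open>\<Theta> k\<close> stays bounded even where \<open>ratio k\<close> tends to zero.\<close>

lemma u_altdef: "u k = \<Theta> k * ((1 - \<beta> k * q ^ k) * (1 - ratio k)) * H k"
proof -
  have "ratio k * - ((1 - \<beta> k * q ^ k) * (1 - \<beta> k / (a * q ^ k))) = (1 - \<beta> k * q ^ k) * (1 - ratio k)"
    using \<beta>_nonzero[of k] q nz by (simp add: ratio_def field_simps)
  then show ?thesis unfolding u_def \<Theta>_Suc by (simp only: mult.assoc[of "\<Theta> k" "ratio k"])
qed

text \<open>On a step in direction \<open>b\<close> the ratio is
  \<open>q ^ (k - B k) * a / b\<close>. Adding the four possible values removes the dependence on
  the direction taken at \<open>k\<close>.\<close>

lemma ratio_bound:
  "norm (ratio k) \<le> norm q ^ (k - B k) * norm (a / b) + norm q ^ (k - C k) * norm (a / c)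
     + norm q ^ (k - D k) * norm (a / d) + norm q ^ (k - E k) * norm (a / e)" (is "_ \<le> ?R")
proof -
  have eq: "norm (q ^ k * a / (x * q ^ m)) = norm q ^ (k - m) * norm (a / x)" if "m \<le> k" for x m
  proof -
    have "q ^ k = q ^ (k - m) * q ^ m" using that by (simp add: power_add[symmetric])
    then show ?thesis using q by (simp add: norm_mult norm_divide norm_power)
  qed
  have nn: "0 \<le> norm q ^ (k - m) * norm (a / x)" for m x
    by simp
  have le: "norm (q ^ k * a / (b * q ^ B k)) \<le> ?R" "norm (q ^ k * a / (c * q ^ C k)) \<le> ?R"
    "norm (q ^ k * a / (d * q ^ D k)) \<le> ?R" "norm (q ^ k * a / (e * q ^ E k)) \<le> ?R"
    unfolding eq[OF path_le(1)] eq[OF path_le(2)] eq[OF path_le(3)] eq[OF path_le(4)]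
    using nn[of "B k" b] nn[of "C k" c] nn[of "D k" d] nn[of "E k" e] by linarith+
  show ?thesis
    unfolding ratio_def using \<beta>_cases[of k] le by (elim disjE) (simp_all only:)
qed

lemma ratio_axis:
  "(\<And>n. B n = n) \<Longrightarrow> ratio k = a / b" "(\<And>n. C n = n) \<Longrightarrow> ratio k = a / c"
  "(\<And>n. D n = n) \<Longrightarrow> ratio k = a / d" "(\<And>n. E n = n) \<Longrightarrow> ratio k = a / e"
  using step[of k] q by (auto simp: ratio_def)

lemma ratio_tendsto_0:
  assumes "filterlim (\<lambda>k. k - B k) at_top sequentially" "filterlim (\<lambda>k. k - C k) at_top sequentially"
    "filterlim (\<lambda>k. k - D k) at_top sequentially" "filterlim (\<lambda>k. k - E k) at_top sequentially"
  shows "ratio \<longlonglongrightarrow> 0"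
proof (rule Lim_null_comparison)
  have "(\<lambda>n. norm q ^ n) \<longlonglongrightarrow> 0" using q by (intro LIMSEQ_power_zero) simp
  then have lim: "(\<lambda>k. norm q ^ (k - F k)) \<longlonglongrightarrow> 0"
    if "filterlim (\<lambda>k. k - F k) at_top sequentially" for F
    using that by (rule filterlim_compose)
  have "(\<lambda>k. norm q ^ (k - B k) * norm (a / b) + norm q ^ (k - C k) * norm (a / c)
     + norm q ^ (k - D k) * norm (a / d) + norm q ^ (k - E k) * norm (a / e)) \<longlonglongrightarrow>
     0 * norm (a / b) + 0 * norm (a / c) + 0 * norm (a / d) + 0 * norm (a / e)"
    by (intro tendsto_add tendsto_mult tendsto_const lim assms)
  then show "(\<lambda>k. norm q ^ (k - B k) * norm (a / b) + norm q ^ (k - C k) * norm (a / c)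
     + norm q ^ (k - D k) * norm (a / d) + norm q ^ (k - E k) * norm (a / e)) \<longlonglongrightarrow> 0"
    by simp
qed (simp add: ratio_bound always_eventually)

lemma H_bounded: "\<exists>M>0. \<forall>n. norm (H n) \<le> M"
proof -
  have up: "\<exists>M>0. \<forall>n. norm (qpoch x q n) \<le> M" for x
    using qpoch_bounded[OF q(2), of "norm x"] by blast
  obtain M where M: "\<And>x. M x > 0" "\<And>x n. norm (qpoch x q n) \<le> M x"
    using up by metis
  note lo = qpoch_lower[OF q(2)]
  obtain k0 where k0: "k0 > 0" "\<And>n. k0 \<le> norm (qpoch q q n)" using lo[OF den_q] by blast
  obtain k1 where k1: "k1 > 0" "\<And>n. k1 \<le> norm (qpoch (q * a / b) q n)" using lo[OF den(1)] by blast
  obtain k2 where k2: "k2 > 0" "\<And>n. k2 \<le> norm (qpoch (q * a / c) q n)" using lo[OF den(2)] by blast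
  obtain k3 where k3: "k3 > 0" "\<And>n. k3 \<le> norm (qpoch (q * a / d) q n)" using lo[OF den(3)] by blast
  obtain k4 where k4: "k4 > 0" "\<And>n. k4 \<le> norm (qpoch (q * a / e) q n)" using lo[OF den(4)] by blast
  define K where "K = (M b * M c * M d * M e) / (k1 * k2 * k3 * k4)
    * (M (b * c / a) * M (b * d / a) * M (b * e / a) * M (c * d / a) * M (c * e / a) * M (d * e / a)) / k0"
  have "norm (H n) \<le> K" for n
    unfolding H_def K_def norm_divide norm_mult
    using M(1) k0(1) k1(1) k2(1) k3(1) k4(1)
    by (intro frac_le mult_mono M(2) k0(2) k1(2) k2(2) k3(2) k4(2))
       (auto intro!: mult_nonneg_nonneg divide_nonneg_pos simp: less_imp_le)
  moreover have "K > 0" unfolding K_def using M(1) k0(1) k1(1) k2(1) k3(1) k4(1) by simp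
  ultimately show ?thesis by blast
qed

text \<open>As for \<open>H_bounded\<close> with numerator and denominator exchanged; the numerator
  is controlled only along the path, hence \<open>qpoch_lower_mono\<close>.\<close>

lemma H_lower:
  assumes nzH: "\<And>n. H n \<noteq> 0"
  shows "\<exists>m>0. \<forall>n. m \<le> norm (H n)"
proof -
  have up: "\<exists>M>0. \<forall>n. norm (qpoch x q n) \<le> M" for x
    using qpoch_bounded[OF q(2), of "norm x"] by blast
  obtain M where M: "\<And>x. M x > 0" "\<And>x n. norm (qpoch x q n) \<le> M x"
    using up by metis
  have lo: "\<exists>c>0. \<forall>n. c \<le> norm (qpoch x q (f n))"
    if "mono f" "\<And>n. H n \<noteq> 0 \<Longrightarrow> qpoch x q (f n) \<noteq> 0" for x f
    using qpoch_lower_mono[OF q(2) that(1), of x] that(2) nzH by blast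
  obtain k1 where k1: "k1 > 0" "\<And>n. k1 \<le> norm (qpoch b q (B n))"
    using lo[OF mono_path(1), of b] by (auto simp: H_def)
  obtain k2 where k2: "k2 > 0" "\<And>n. k2 \<le> norm (qpoch c q (C n))"
    using lo[OF mono_path(2), of c] by (auto simp: H_def)
  obtain k3 where k3: "k3 > 0" "\<And>n. k3 \<le> norm (qpoch d q (D n))"
    using lo[OF mono_path(3), of d] by (auto simp: H_def)
  obtain k4 where k4: "k4 > 0" "\<And>n. k4 \<le> norm (qpoch e q (E n))"
    using lo[OF mono_path(4), of e] by (auto simp: H_def)
  obtain l1 where l1: "l1 > 0" "\<And>n. l1 \<le> norm (qpoch (b * c / a) q (B n + C n))"
    using lo[OF mono_path_add(1), of "b * c / a"] by (auto simp: H_def)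
  obtain l2 where l2: "l2 > 0" "\<And>n. l2 \<le> norm (qpoch (b * d / a) q (B n + D n))"
    using lo[OF mono_path_add(2), of "b * d / a"] by (auto simp: H_def)
  obtain l3 where l3: "l3 > 0" "\<And>n. l3 \<le> norm (qpoch (b * e / a) q (B n + E n))"
    using lo[OF mono_path_add(3), of "b * e / a"] by (auto simp: H_def)
  obtain l4 where l4: "l4 > 0" "\<And>n. l4 \<le> norm (qpoch (c * d / a) q (C n + D n))"
    using lo[OF mono_path_add(4), of "c * d / a"] by (auto simp: H_def)
  obtain l5 where l5: "l5 > 0" "\<And>n. l5 \<le> norm (qpoch (c * e / a) q (C n + E n))"
    using lo[OF mono_path_add(5), of "c * e / a"] by (auto simp: H_def)
  obtain l6 where l6: "l6 > 0" "\<And>n. l6 \<le> norm (qpoch (d * e / a) q (D n + E n))"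
    using lo[OF mono_path_add(6), of "d * e / a"] by (auto simp: H_def)
  define K where "K = (k1 * k2 * k3 * k4) / (M (q * a / b) * M (q * a / c) * M (q * a / d) * M (q * a / e))
    * (l1 * l2 * l3 * l4 * l5 * l6) / M q"
  have "K \<le> norm (H n)" for n
    unfolding H_def K_def norm_divide norm_mult
    using M(1) k1(1) k2(1) k3(1) k4(1) l1(1) l2(1) l3(1) l4(1) l5(1) l6(1) den_q den
    by (intro frac_le mult_mono M(2) k1(2) k2(2) k3(2) k4(2) l1(2) l2(2) l3(2) l4(2) l5(2) l6(2))
       (auto intro!: mult_nonneg_nonneg divide_nonneg_pos mult_pos_pos simp: less_imp_le)
  moreover have "K > 0"
    unfolding K_def using M(1) k1(1) k2(1) k3(1) k4(1) l1(1) l2(1) l3(1) l4(1) l5(1) l6(1) by simp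
  ultimately show ?thesis by blast
qed

text \<open>A zero can only come from a numerator factor; it persists because the indices of all
  these factors are monotone along the path.\<close>

lemma H_zero_mono:
  assumes "H m = 0" "m \<le> n"
  shows "H n = 0"
proof -
  have mn: "B m \<le> B n" "C m \<le> C n" "D m \<le> D n" "E m \<le> E n"
    "B m + C m \<le> B n + C n" "B m + D m \<le> B n + D n" "B m + E m \<le> B n + E n"
    "C m + D m \<le> C n + D n" "C m + E m \<le> C n + E n" "D m + E m \<le> D n + E n"
    using mono_path assms(2) by (auto simp: mono_def add_mono)
  then show ?thesis
    using assms(1) den_q den qpoch_eq_0_mono[OF _ mn(1)] qpoch_eq_0_mono[OF _ mn(2)]
      qpoch_eq_0_mono[OF _ mn(3)] qpoch_eq_0_mono[OF _ mn(4)] qpoch_eq_0_mono[OF _ mn(5)]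
      qpoch_eq_0_mono[OF _ mn(6)] qpoch_eq_0_mono[OF _ mn(7)] qpoch_eq_0_mono[OF _ mn(8)]
      qpoch_eq_0_mono[OF _ mn(9)] qpoch_eq_0_mono[OF _ mn(10)]
    by (auto simp: H_def)
qed

text \<open>The ratio test applies to \<open>\<Theta>\<close>; the other factors of
  \<open>u_altdef\<close> are bounded from some index on.\<close>

lemma summable_norm_u:
  assumes \<rho>: "\<rho> < 1" "eventually (\<lambda>k. norm (ratio k) \<le> \<rho>) sequentially"
  shows "summable (\<lambda>k. norm (u k))"
proof -
  obtain N where N: "\<And>k. k \<ge> N \<Longrightarrow> norm (ratio k) \<le> \<rho>"
    using \<rho>(2) by (auto simp: eventually_sequentially)
  have "norm (\<Theta> (Suc k)) \<le> \<rho> * norm (\<Theta> k)" if "k \<ge> N" for k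
    using mult_right_mono[OF N[OF that] norm_ge_zero[of "\<Theta> k"]]
    by (simp add: \<Theta>_Suc norm_mult mult_ac)
  then have sum: "summable (\<lambda>k. norm (\<Theta> k))"
    using \<rho>(1) by (intro summable_ratio_test[of \<rho> N]) auto
  obtain M where M: "M > 0" "\<And>n. norm (H n) \<le> M" using H_bounded by blast
  define S where "S = norm b + norm c + norm d + norm e"
  have \<beta>: "norm (\<beta> k * q ^ k) \<le> S" for k
  proof -
    have 1: "norm (x * q ^ m * q ^ k) \<le> norm x" for x m
      using q by (simp add: norm_mult norm_power mult.assoc power_add[symmetric] mult_left_le power_le_one)
    have "norm (b * q ^ B k * q ^ k) \<le> S" "norm (c * q ^ C k * q ^ k) \<le> S"
      "norm (d * q ^ D k * q ^ k) \<le> S" "norm (e * q ^ E k * q ^ k) \<le> S"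
      using 1[of b "B k"] 1[of c "C k"] 1[of d "D k"] 1[of e "E k"] norm_ge_zero[of b]
        norm_ge_zero[of c] norm_ge_zero[of d] norm_ge_zero[of e] unfolding S_def by linarith+
    then show ?thesis
      using \<beta>_cases[of k] by (elim disjE) (simp_all only:)
  qed
  have tri: "norm (1 - x) \<le> 1 + y" if "norm x \<le> y" for x :: complex and y
    using that norm_triangle_ineq4[of 1 x] by simp
  have "norm (u k) \<le> norm (\<Theta> k) * (((1 + S) * (1 + 1)) * M)" if k: "k \<ge> N" for k
  proof -
    have "norm (ratio k) \<le> 1" using N[OF k] \<rho>(1) by simp
    then show ?thesis
      unfolding u_altdef norm_mult mult.assoc
      using tri[OF \<beta>[of k]] tri[of "ratio k" 1] M(1) M(2)[of k]
      by (intro mult_left_mono mult_mono) (auto simp: S_def)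
  qed
  moreover have "summable (\<lambda>k. norm (\<Theta> k) * (((1 + S) * (1 + 1)) * M))"
    by (rule summable_mult2[OF sum])
  ultimately show ?thesis
    by (intro summable_comparison_test[of "\<lambda>k. norm (u k)"]) auto
qed

text \<open>If \<open>norm r\<close> were at least \<open>1\<close>, then \<open>\<Theta>\<close>
  and \<open>H\<close> would both be bounded away from zero, so \<open>u\<close> tending to zero
  would force \<open>(1 - \<beta> k * q ^ k) * (1 - r)\<close> to zero. Its limit is
  \<open>1 - r\<close>, which is nonzero.\<close>

lemma constant_ratio:
  assumes \<phi>: "\<phi> 1 1 \<noteq> 0" and nzH: "\<And>n. H n \<noteq> 0" and lim: "u \<longlonglongrightarrow> 0"
    and const: "\<And>k. ratio k = r"
  shows "norm r < 1"
proof (rule ccontr)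
  assume "\<not> norm r < 1"
  then have r: "1 \<le> norm r" by simp
  then have r0: "r \<noteq> 0" by auto
  \<comment> \<open>This is a factor of \<open>\<phi> 1 1\<close>, and \<open>r\<close> equals
    \<open>a / \<beta> 0\<close>; so \<open>r = 1\<close> is excluded.\<close>
  have "1 - \<beta> 0 / a \<noteq> 0" using \<phi> \<phi>_Suc[of 1 0] by auto
  then have r1: "r \<noteq> 1"
    using const[of 0] nz \<beta>_nonzero[of 0] by (auto simp: ratio_def)
  have \<Theta>: "1 \<le> norm (\<Theta> k)" for k
  proof (induction k)
    case (Suc k)
    then show ?case
      using r mult_mono[of 1 "norm (\<Theta> k)" 1 "norm r"] by (simp add: \<Theta>_Suc const norm_mult)
  qed (simp add: \<Theta>_0)
  obtain m where m: "m > 0" "\<And>n. m \<le> norm (H n)" using H_lower[OF nzH] by blast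
  have "\<beta> k * q ^ k = q ^ k * q ^ k * a / r" for k
  proof -
    have "\<beta> k = q ^ k * a / r"
      using const[of k] r0 \<beta>_nonzero[of k] by (auto simp: ratio_def field_simps)
    then show ?thesis by simp
  qed
  moreover have "(\<lambda>k. q ^ k * q ^ k * a / r) \<longlonglongrightarrow> 0 * 0 * a / r"
    using r by (intro tendsto_intros LIMSEQ_power_zero q(2)) auto
  ultimately have "(\<lambda>k. \<beta> k * q ^ k) \<longlonglongrightarrow> 0 * 0 * a / r"
    by simp
  then have "(\<lambda>k. norm ((1 - \<beta> k * q ^ k) * (1 - r))) \<longlonglongrightarrow> norm ((1 - 0 * 0 * a / r) * (1 - r))"
    by (intro tendsto_norm tendsto_mult tendsto_diff tendsto_const)
  moreover have "(\<lambda>k. norm ((1 - \<beta> k * q ^ k) * (1 - r))) \<longlonglongrightarrow> 0"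
  proof (rule Lim_null_comparison)
    show "(\<lambda>k. norm (u k) / m) \<longlonglongrightarrow> 0"
      using tendsto_divide[OF tendsto_norm_zero[OF lim] tendsto_const[of m]] m(1) by simp
    have "norm ((1 - \<beta> k * q ^ k) * (1 - r)) \<le> norm (u k) / m" for k
    proof -
      have "1 * norm ((1 - \<beta> k * q ^ k) * (1 - r)) * m \<le> norm (u k)"
        unfolding u_altdef const norm_mult[of "\<Theta> k * _"] norm_mult[of "\<Theta> k"]
        using m(1) m(2)[of k] \<Theta>[of k] by (intro mult_mono) auto
      then show ?thesis using m(1) by (simp add: field_simps)
    qed
    then show "eventually (\<lambda>k. norm (norm ((1 - \<beta> k * q ^ k) * (1 - r))) \<le> norm (u k) / m) sequentially"
      by simp
  qed
  ultimately show False using LIMSEQ_unique r1 by fastforce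
qed

lemma u_sums:
  assumes \<phi>: "\<And>n k. k \<le> Suc n \<Longrightarrow> \<phi> (q ^ n) k \<noteq> 0"
    and den_inf: "qpoch_inf (q * a / b) q \<noteq> 0" "qpoch_inf (q * a / c) q \<noteq> 0"
      "qpoch_inf (q * a / d) q \<noteq> 0" "qpoch_inf (q * a / e) q \<noteq> 0"
    and summable: "summable (\<lambda>k. norm (u k))"
  shows "u sums ((qpoch_inf b q * qpoch_inf c q * qpoch_inf d q * qpoch_inf e q)
     / (qpoch_inf (q * a / b) q * qpoch_inf (q * a / c) q * qpoch_inf (q * a / d) q * qpoch_inf (q * a / e) q))"
    (is "u sums ?G")
proof -
  \<comment> \<open>Padding with zeros beyond \<open>k = n\<close> makes the finite expansions
    infinite series, as Tannery's theorem requires.\<close>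
  define f where "f = (\<lambda>k n. if k \<le> n then u k * W n k else 0)"
  obtain M N where W: "\<And>n k. n \<ge> N \<Longrightarrow> k \<le> n \<Longrightarrow> norm (W n k) \<le> M"
    using W_bounded[OF \<phi>] by blast
  have "(\<lambda>n. suminf (\<lambda>k. f k n)) \<longlonglongrightarrow> suminf u"
  proof (rule tannerys_theorem[THEN conjunct2, THEN conjunct2])
    fix k
    have "(\<lambda>n. u k * W n k) \<longlonglongrightarrow> u k * 1" by (intro tendsto_intros W_tendsto)
    moreover have "eventually (\<lambda>n. u k * W n k = f k n) sequentially"
      by (auto simp: f_def eventually_sequentially)
    ultimately show "f k \<longlonglongrightarrow> u k"
      by (auto intro: Lim_transform_eventually)
  next
    have "norm (f k n) \<le> norm (u k) * \<bar>M\<bar>" if "n \<ge> N" for k n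
      using mult_left_mono[OF order_trans[OF W[OF that] abs_ge_self[of M]] norm_ge_zero[of "u k"]]
      by (simp add: f_def norm_mult)
    then show "eventually (\<lambda>(k, n). norm (f k n) \<le> norm (u k) * \<bar>M\<bar>) (at_top \<times>\<^sub>F sequentially)"
      unfolding eventually_prod_filter
      by (intro exI[of _ "\<lambda>_. True"] exI[of _ "\<lambda>n. n \<ge> N"]) (auto simp: eventually_sequentially)
  next
    show "summable (\<lambda>k. norm (u k) * \<bar>M\<bar>)" using summable by (rule summable_mult2)
  qed simp
  moreover have "suminf (\<lambda>k. f k n) = G n" for n
  proof -
    have "suminf (\<lambda>k. f k n) = (\<Sum>k\<le>n. f k n)"
      by (intro suminf_finite) (auto simp: f_def)
    also have "\<dots> = (\<Sum>k\<le>n. u k * W n k)"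
      by (intro sum.cong) (auto simp: f_def)
    also have "\<dots> = G n"
      using \<phi> by (intro finite_expansion[symmetric])
    finally show ?thesis .
  qed
  ultimately have "suminf u = ?G"
    using G_tendsto[OF den_inf] LIMSEQ_unique by auto
  then show ?thesis
    using summable_sums[OF summable_norm_cancel[OF summable]] by simp
qed

end

section \<open>Floor-type splittings and the grouped series\<close>

lemma filterlim_minus_floor_at_top:
  fixes lam Lam eps :: nat
  assumes "lam < Lam"
  shows "filterlim (\<lambda>n. n - (eps + n * lam) div Lam) at_top sequentially"
  unfolding filterlim_at_top
proof
  fix Z
  \<comment> \<open>As \<open>lam + 1 \<le> Lam\<close>, the gap \<open>n * Lam - n * lam\<close> is
    at least \<open>n\<close>, which must cover \<open>eps\<close> and \<open>Z\<close> multiples of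
    \<open>Lam\<close>.\<close>
  have "Z \<le> n - (eps + n * lam) div Lam" if n: "n \<ge> eps + Z * Lam" for n
  proof -
    have "n + n * lam \<le> n * Lam"
      using assms mult_le_mono2[of "Suc lam" Lam n] by simp
    with n have "eps + n * lam + Z * Lam \<le> n * Lam" by simp
    then have "(eps + n * lam + Z * Lam) div Lam \<le> (n * Lam) div Lam"
      by (rule div_le_mono)
    then show ?thesis using assms by simp
  qed
  then show "eventually (\<lambda>n. Z \<le> n - (eps + n * lam) div Lam) sequentially"
    unfolding eventually_sequentially by blast
qed

theorem theorem4:
  fixes q a b c d :: complex
    and eps_b eps_c eps_d eps_e lam_b lam_c lam_d lam_e Lam \<delta> :: nat
    and B C D E :: "nat \<Rightarrow> nat"
    and \<phi> :: "complex \<Rightarrow> nat \<Rightarrow> complex"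
    and H \<Theta> :: "nat \<Rightarrow> complex"
  assumes q: "0 < norm q" "norm q < 1"
    and nz: "a \<noteq> 0" "b \<noteq> 0" "c \<noteq> 0" "d \<noteq> 0"
    and Lam: "Lam = lam_b + lam_c + lam_d + lam_e" "Lam \<ge> 1"
    and B: "\<And>n. B n = (eps_b + n * lam_b) div Lam"
    and C: "\<And>n. C n = (eps_c + n * lam_c) div Lam"
    and D: "\<And>n. D n = (eps_d + n * lam_d) div Lam"
    and E: "\<And>n. E n = (eps_e + n * lam_e) div Lam"
    and split: "\<And>n. n = B n + C n + D n + E n"
    and \<phi>: "\<phi> = phi q a b c d B C D E"
    and H: "H = H_coeff q a b c d B C D E"
    and \<Theta>: "\<Theta> = Theta q a b c d B C D E"
    and phi_nz: "\<And>n k. k \<le> n + 1 \<Longrightarrow> \<phi> (q ^ n) k \<noteq> 0"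
    and denom_nz: "qpoch_inf (q * a / b) q \<noteq> 0" "qpoch_inf (q * a / c) q \<noteq> 0"
      "qpoch_inf (q * a / d) q \<noteq> 0" "qpoch_inf (b * c * d / a) q \<noteq> 0"
    and H_nz: "\<And>n. n \<ge> 1 \<Longrightarrow> H (n * Lam) \<noteq> 0"
    and conv: "summable (\<lambda>k. \<Theta> (k + 1) * (\<phi> (q ^ k) (k + 1) / (- \<phi> (q ^ k) k)) * H k)"
    and \<delta>: "\<delta> < Lam"
  shows "(qpoch_inf b q * qpoch_inf c q * qpoch_inf d q * qpoch_inf (q * a\<^sup>2 / (b * c * d)) q)
      / (qpoch_inf (q * a / b) q * qpoch_inf (q * a / c) q * qpoch_inf (q * a / d) q
         * qpoch_inf (b * c * d / a) q)
    = (\<Sum>k<\<delta>. \<Theta> (k + 1) * (\<phi> (q ^ k) (k + 1) / (- \<phi> (q ^ k) k)) * H k)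
      + (\<Sum>i. let n = Suc i in
          H (n * Lam) * \<Theta> (n * Lam) *
          (\<Sum>j = int \<delta> - int Lam..int \<delta> - 1.
             let m = nat (j + int (n * Lam)) in
             \<Theta> (1 + m) / \<Theta> (n * Lam)
             * (\<phi> (q ^ m) (1 + m) / (- \<phi> (q ^ m) m))
             * (H m / H (n * Lam))))"
proof -
  define e where "e = q * a\<^sup>2 / (b * c * d)"
  \<comment> \<open>The case distinction finds the index that grows at step \<open>n\<close>; the
    default \<open>e\<close> is right because exactly one does.\<close>
  define \<beta> where "\<beta> = (\<lambda>n. if B (Suc n) \<noteq> B n then b * q ^ B n else if C (Suc n) \<noteq> C n then c * q ^ C n
    else if D (Suc n) \<noteq> D n then d * q ^ D n else e * q ^ E n)"
  have q0: "q \<noteq> 0" using q by auto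
  have e0: "e \<noteq> 0" and bal: "b * c * d * e = q * a\<^sup>2"
    using nz q0 by (simp_all add: e_def)
  have to_e: "q * a / (b * c) = d * e / a" "q * a / (b * d) = c * e / a" "q * a / (c * d) = b * e / a"
    "b * c * d / a = q * a / e" "b * c * d / (q * a) = a / e"
    using nz q0 by (simp_all add: e_def field_simps power2_eq_square)
  have den_e: "qpoch_inf (q * a / e) q \<noteq> 0" using denom_nz(4) unfolding to_e .
  interpret lp: lattice_path q a b c d e B C D E \<beta>
  proof
    show "norm q < 1" "a \<noteq> 0" "b \<noteq> 0" "c \<noteq> 0" "d \<noteq> 0" by fact+
    show "q \<noteq> 0" "e \<noteq> 0" "b * c * d * e = q * a\<^sup>2" by fact+
    show "B n + C n + D n + E n = n" for n using split[of n] by simp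
    show "qpoch (q * a / b) q n \<noteq> 0" "qpoch (q * a / c) q n \<noteq> 0" "qpoch (q * a / d) q n \<noteq> 0"
      "qpoch (q * a / e) q n \<noteq> 0" for n
      using denom_nz den_e q(2) by (simp_all add: qpoch_nonzero)
    fix n
    have "B n \<le> B (Suc n)" "C n \<le> C (Suc n)" "D n \<le> D (Suc n)" "E n \<le> E (Suc n)"
      unfolding B C D E by (auto intro!: div_le_mono)
    \<comment> \<open>Four nondecreasing indices whose sum grows by one: exactly one of them grows,
      and by one.\<close>
    with split[of n] split[of "Suc n"] have
      "B (Suc n) = Suc (B n) \<and> C (Suc n) = C n \<and> D (Suc n) = D n \<and> E (Suc n) = E n \<or>
       B (Suc n) = B n \<and> C (Suc n) = Suc (C n) \<and> D (Suc n) = D n \<and> E (Suc n) = E n \<or>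
       B (Suc n) = B n \<and> C (Suc n) = C n \<and> D (Suc n) = Suc (D n) \<and> E (Suc n) = E n \<or>
       B (Suc n) = B n \<and> C (Suc n) = C n \<and> D (Suc n) = D n \<and> E (Suc n) = Suc (E n)"
      by linarith
    then show "\<beta> n = b * q ^ B n \<and> B (Suc n) = Suc (B n) \<and> C (Suc n) = C n \<and> D (Suc n) = D n \<and> E (Suc n) = E n \<or>
       \<beta> n = c * q ^ C n \<and> B (Suc n) = B n \<and> C (Suc n) = Suc (C n) \<and> D (Suc n) = D n \<and> E (Suc n) = E n \<or>
       \<beta> n = d * q ^ D n \<and> B (Suc n) = B n \<and> C (Suc n) = C n \<and> D (Suc n) = Suc (D n) \<and> E (Suc n) = E n \<or>
       \<beta> n = e * q ^ E n \<and> B (Suc n) = B n \<and> C (Suc n) = C n \<and> D (Suc n) = D n \<and> E (Suc n) = Suc (E n)"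
      unfolding \<beta>_def by (elim disjE) simp_all
  qed
  have \<phi>_lp: "\<phi> = lp.\<phi>"
  proof (intro ext)
    fix x n
    have "q * a\<^sup>2 * x / (b * c * d) = e * x" "q * a / (b * c * d * x) = e / (a * x)"
      using nz by (simp_all add: e_def power2_eq_square)
    then show "\<phi> x n = lp.\<phi> x n" unfolding \<phi> phi_def lp.\<phi>_def by (simp add: mult_ac)
  qed
  have H_lp: "H = lp.H"
    unfolding H H_coeff_def lp.H_def fun_eq_iff to_e e_def[symmetric] split[symmetric]
    by (simp add: mult_ac)
  have \<Theta>_lp: "\<Theta> = lp.\<Theta>"
    unfolding \<Theta> Theta_def lp.\<Theta>_def fun_eq_iff to_e
    using q0 by (simp add: power_int_diff mult_ac)
  define v where "v = (\<lambda>k. \<Theta> (k + 1) * (\<phi> (q ^ k) (k + 1) / (- \<phi> (q ^ k) k)) * H k)"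
  have v_lp: "v = lp.u"
  proof
    fix k
    have "\<phi> (q ^ k) k \<noteq> 0" by (rule phi_nz) simp
    then have "\<phi> (q ^ k) (k + 1) / (- \<phi> (q ^ k) k) = - ((1 - \<beta> k * q ^ k) * (1 - \<beta> k / (a * q ^ k)))"
      by (simp add: \<phi>_lp lp.\<phi>_Suc)
    then show "v k = lp.u k" unfolding v_def lp.u_def by (simp add: \<Theta>_lp H_lp)
  qed
  have \<phi>_nz: "lp.\<phi> (q ^ n) k \<noteq> 0" if "k \<le> Suc n" for n k
    using phi_nz[of k n] that by (simp add: \<phi>_lp)
  \<comment> \<open>Nonvanishing at the positive multiples of \<open>Lam\<close> reaches every
    index, since a zero would persist up to the next such multiple.\<close>
  have "H n \<noteq> 0" for n
  proof
    assume "H n = 0"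
    moreover have "n \<le> Suc n * Lam" using Lam(2) by (cases Lam) auto
    ultimately have "H (Suc n * Lam) = 0" unfolding H_lp by (rule lp.H_zero_mono)
    with H_nz[of "Suc n"] show False by simp
  qed
  moreover have "lp.u \<longlonglongrightarrow> 0"
    unfolding v_lp[symmetric] using conv unfolding v_def by (rule summable_LIMSEQ_zero)
  ultimately have "norm r < 1" if "\<And>k. lp.ratio k = r" for r
    using lp.constant_ratio[OF _ _ _ that] \<phi>_nz[of 1 0] unfolding H_lp by simp
  then have geometric: "\<exists>\<rho><1. eventually (\<lambda>k. norm (lp.ratio k) \<le> \<rho>) sequentially"
    if "\<And>k. lp.ratio k = r" for r
    using that by (intro exI[of _ "norm r"]) simp
  \<comment> \<open>For slope one the floor is \<open>n + eps div Lam\<close>, and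
    \<open>f 0 \<le> 0\<close> kills the offset.\<close>
  have axis: "f n = n" if "\<And>n. f n = (eps + n * Lam) div Lam" "\<And>n. f n \<le> n" for f eps n
    using that(1)[of n] that(1)[of 0] that(2)[of 0] Lam(2) by simp
  have "\<exists>\<rho><1. eventually (\<lambda>k. norm (lp.ratio k) \<le> \<rho>) sequentially"
  \<comment> \<open>Either all four slopes are below one and the ratio tends to zero, or the path
    follows one axis and the ratio is constant.\<close>
  proof (cases "lam_b < Lam \<and> lam_c < Lam \<and> lam_d < Lam \<and> lam_e < Lam")
    case True
    then have "lp.ratio \<longlonglongrightarrow> 0"
      unfolding B C D E
      by (intro lp.ratio_tendsto_0) (simp_all add: B C D E filterlim_minus_floor_at_top)
    then have "eventually (\<lambda>k. norm (lp.ratio k) < 1 / 2) sequentially"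
      using order_tendstoD(2)[OF tendsto_norm_zero, of lp.ratio sequentially "1/2"] by simp
    then show ?thesis
      by (intro exI[of _ "1 / 2"] conjI) (auto elim: eventually_mono)
  next
    case False
    then consider "lam_b = Lam" | "lam_c = Lam" | "lam_d = Lam" | "lam_e = Lam"
      using Lam(1) by linarith
    then show ?thesis
    proof cases
      case 1
      then have "B n = n" for n using axis[of B eps_b] B lp.path_le by simp
      then show ?thesis using lp.ratio_axis(1) geometric by blast
    next
      case 2
      then have "C n = n" for n using axis[of C eps_c] C lp.path_le by simp
      then show ?thesis using lp.ratio_axis(2) geometric by blast
    next
      case 3
      then have "D n = n" for n using axis[of D eps_d] D lp.path_le by simp
      then show ?thesis using lp.ratio_axis(3) geometric by blast
    next
      case 4
      then have "E n = n" for n using axis[of E eps_e] E lp.path_le by simp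
      then show ?thesis using lp.ratio_axis(4) geometric by blast
    qed
  qed
  then have "summable (\<lambda>k. norm (lp.u k))"
    using lp.summable_norm_u by blast
  then have v_sums: "v sums ((qpoch_inf b q * qpoch_inf c q * qpoch_inf d q * qpoch_inf e q)
      / (qpoch_inf (q * a / b) q * qpoch_inf (q * a / c) q * qpoch_inf (q * a / d) q * qpoch_inf (q * a / e) q))"
    (is "v sums ?G")
    unfolding v_lp using denom_nz den_e \<phi>_nz by (intro lp.u_sums)
  \<comment> \<open>The prefactors cancel, and \<open>j + n * Lam\<close> with
    \<open>n = Suc i\<close> runs over \<open>Lam\<close> consecutive indices from
    \<open>i * Lam + \<delta>\<close>; these are nonnegative, so \<open>nat\<close> loses
    nothing.\<close>
  have block: "(let n = Suc i in
          H (n * Lam) * \<Theta> (n * Lam) *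
          (\<Sum>j = int \<delta> - int Lam..int \<delta> - 1.
             let m = nat (j + int (n * Lam)) in
             \<Theta> (1 + m) / \<Theta> (n * Lam)
             * (\<phi> (q ^ m) (1 + m) / (- \<phi> (q ^ m) m))
             * (H m / H (n * Lam)))) = (\<Sum>m = i * Lam..<i * Lam + Lam. v (m + \<delta>))" for i
  proof -
    define n where "n = Suc i"
    have H0: "H (n * Lam) \<noteq> 0" by (rule H_nz) (simp add: n_def)
    have \<Theta>0: "\<Theta> (n * Lam) \<noteq> 0" using nz q0 e0 by (simp add: \<Theta>_lp lp.\<Theta>_def)
    have summand: "H (n * Lam) * \<Theta> (n * Lam) * (\<Theta> (1 + m) / \<Theta> (n * Lam)
        * (\<phi> (q ^ m) (1 + m) / (- \<phi> (q ^ m) m)) * (H m / H (n * Lam))) = v m" for m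
      using H0 \<Theta>0 by (simp add: v_def)
    have "(\<Sum>j = int \<delta> - int Lam..int \<delta> - 1. v (nat (j + int (P + Lam))))
        = (\<Sum>m = P..<P + Lam. v (m + \<delta>))" for P
      by (rule sum.reindex_bij_witness[of _ "\<lambda>m. int m + int \<delta> - int (P + Lam)"
            "\<lambda>j. nat (j + int (P + Lam)) - \<delta>"])
         (auto intro!: arg_cong[of _ _ v])
    from this[of "i * Lam"] have "(\<Sum>j = int \<delta> - int Lam..int \<delta> - 1. v (nat (j + int (n * Lam))))
        = (\<Sum>m = i * Lam..<i * Lam + Lam. v (m + \<delta>))"
      by (simp add: n_def add.commute)
    then show ?thesis
      unfolding Let_def n_def[symmetric] sum_distrib_left summand .
  qed
  \<comment> \<open>The first \<open>\<delta>\<close> terms are split off; the remaining convergent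
    series is grouped into blocks of length \<open>Lam\<close>.\<close>
  have "(\<lambda>m. v (m + \<delta>)) sums (?G - (\<Sum>k<\<delta>. v k))"
    using v_sums by (rule sums_split_initial_segment)
  then have "(\<lambda>i. \<Sum>m = i * Lam..<i * Lam + Lam. v (m + \<delta>)) sums (?G - (\<Sum>k<\<delta>. v k))"
    using Lam(2) by (intro sums_group) auto
  then have "?G = (\<Sum>k<\<delta>. v k) + (\<Sum>i. \<Sum>m = i * Lam..<i * Lam + Lam. v (m + \<delta>))"
    by (simp add: sums_iff)
  then show ?thesis
    unfolding block to_e e_def[symmetric] by (simp only: v_def)
qed

end
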